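(* We have $L^0(\boldsymbol{x},t)=1$, $L^1(\boldsymbol{x},t)=\dfrac{x_1}{(1-x_1)(1-x_1t)}$, and for $k\ge2$, \begin{align*} L^k(\boldsymbol{x},t) = & \, \frac{1}{1-x_1}\bigg[(x_1+x_1^2t)L^{k-1}(\boldsymbol{x},t;\hat{x}_1) +x_1^2t\big(L^k_1(\boldsymbol{x},t) +(t-1)D_1^k(\boldsymbol{x},t)\big) \\ & +\sum_{i=2}^k x_1x_i \big[(t+1)L^{k-1}(\boldsymbol{x},t; \hat{x}_1)+ L_{i-1}^{k-1}(\boldsymbol{x},t; \hat{x}_i)+(t-1)D_{i-1}^{k-1}(\boldsymbol{x},t;\hat{x}_i) \\ &+ L^{k-2}(\boldsymbol{x},t; \hat{x}_1, \hat{x}_i) + t\big(L_i^k(\boldsymbol{x},t)+(t-1)D_i^k(\boldsymbol{x},t)\big) +L_{i-1}^k(\boldsymbol{x},t) +(t-1)D_{i-1}^k(\boldsymbol{x},t)\big] \bigg]; \end{align*} for $k\ge1$, $L^k_k(\boldsymbol{x},t)=D^k_k(\boldsymbol{x},t)$, and for $1\le j<k$, \begin{align*} L_j^k(\boldsymbol{x},t) = & \, \frac{1}{1-x_1x_{j+1}}\bigg[D_j^k(\boldsymbol{x},t) + \sum_{i=j+2}^k x_1x_{i} L_{i-1}^k(\boldsymbol{x},t) \\ & + \sum_{i=j+1}^k x_1x_i \big[(t+1)L^{k-1}(\boldsymbol{x},t; \hat{x}_1)+ L_{i-1}^{k-1}(\boldsymbol{x},t; \hat{x}_i)+(t-1)D_{i-1}^{k-1}(\boldsymbol{x},t;\hat{x}_i)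 \\ &+ L^{k-2}(\boldsymbol{x},t; \hat{x}_1, \hat{x}_i) + t\big(L_i^k(\boldsymbol{x},t)+(t-1)D_i^k(\boldsymbol{x},t)\big) +(t-1)D_{i-1}^k(\boldsymbol{x},t)\big] \bigg]; \end{align*} for $k\ge1$, $D^k_1(\boldsymbol{x},t)=\dfrac{x_1}{1-x_1t}L^{k-1}(\boldsymbol{x},t;\hat x_1)$, and for $2\le i\le k$, \begin{align*} D_i^k(\boldsymbol{x},t) = & \, \frac{1}{1-x_1x_it^2}\bigg[D_{i-1}^k(\boldsymbol{x},t)\\ & +x_1x_i\big[tD_{i-1}^k(\boldsymbol{x},t) +tD_{i-1}^{k-1}(\boldsymbol{x},t; \hat{x}_i)+L^{k-2}(\boldsymbol{x},t; \hat{x}_1, \hat{x}_i) + (t+1)L^{k-1}(\boldsymbol{x},t; \hat{x}_1)\big]\bigg]. \end{align*}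
   Context: $\mathcal{S}_n$ is the set of permutations of $[n]$, in one-line notation $\pi=\pi_1\cdots\pi_n$. A sequence is unimodal if it is strictly increasing and then strictly decreasing. For a composition $\lambda=(\lambda_1,\ldots,\lambda_k)$ of $n$ (positive integers summing to $n$), $\pi\in\mathcal{S}_n$ is $\lambda$-unimodal if cutting its one-line notation into consecutive segments of lengths $\lambda_1,\ldots,\lambda_k$ gives unimodal segments. An involution is a permutation equal to its own inverse; $\mathcal{I}^\lambda$ is the set of $\lambda$-unimodal involutions. Let $s^i_\lambda=\lambda_1+\cdots+\lambda_i$. For $1\le j\le k$, $\mathcal{I}^\lambda_j$ is the set of $\pi\in\mathcal{I}^\lambda$ such that either ($\pi_1\le s^j_\lambda$ and $\pi_1>\pi_2>\cdots>\pi_{\lambda_1}$) or $\pi_1>s^j_\lambda$; $\mathcal{D}^\lambda_j$ is the set of $\pi\in\mathcal{I}^\lambda$ with $\pi_1\le s^j_\lambda$ and $\pi_1>\cdots>\pi_{\lambda_1}$. A descent of $\pi$ is a position $i$ with $\pi_i>\pi_{i+1}$; the $\lambda$-descents are the descents not in $\{s^1_\lambda,\ldots,s^{k-1}_\lambda\}$, and $\operatorname{des}_\lambda(\pi)$ is their number. $\Lambda_m$ is the set of compositions with exactly $m$ parts; $\boldsymbol{x}=(x_1,\ldots,x_k)$ and $t$ are indeterminates, $x^\lambda=\prod x_i^{\lambda_i}$. Define $L^m(\boldsymbol{x},t)=\sum_{\lambda\in\Lambda_m}\sum_{\pi\in\mathcal{I}^\lambda}x^\lambda t^{\operatorname{des}_\lambda(\pi)}$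 (with $L^0=1$), $L^m_j(\boldsymbol{x},t)=\sum_{\lambda\in\Lambda_m}\sum_{\pi\in\mathcal{I}^\lambda_j}x^\lambda t^{\operatorname{des}_\lambda(\pi)}$, $D^m_j(\boldsymbol{x},t)=\sum_{\lambda\in\Lambda_m}\sum_{\pi\in\mathcal{D}^\lambda_j}x^\lambda t^{\operatorname{des}_\lambda(\pi)}$. For such a series $F$ in $k-r$ of the $x$-variables, $F(\boldsymbol{x},t;\hat x_{i_1},\ldots,\hat x_{i_r})$ denotes $F$ evaluated at $x_1,\ldots,x_k$ with $x_{i_1},\ldots,x_{i_r}$ deleted, in increasing order of index (and the same $t$). *)

theory Defs
  imports
    "HOL-Library.Poly_Mapping"
    "HOL-Library.Infinite_Set"
    "HOL-Computational_Algebra.Polynomial"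
    "HOL-Combinatorics.Permutations"
begin

section \<open>Formal power series in the indeterminates $x_0, x_1, x_2, \ldots$\<close>

text \<open>
  A monomial is an exponent vector of type \<^typ>\<open>nat \<Rightarrow>\<^sub>0 nat\<close>, and a power series is an
  arbitrary function from monomials to coefficients. Only $x_1, x_2, \ldots$ are used below;
  \<^term>\<open>0::nat\<close> is a spare index.
\<close>

typedef 'a mfps = "UNIV :: ((nat \<Rightarrow>\<^sub>0 nat) \<Rightarrow> 'a) set"
  morphisms mcoeff Abs_mfps
  by simp

lemma mcoeff_Abs [simp]: "mcoeff (Abs_mfps f) = f"
  by (simp add: Abs_mfps_inverse)

lemma mfps_eqI: "(\<And>\<mu>. mcoeff f \<mu> = mcoeff g \<mu>) \<Longrightarrow> f = g"
  by (metis ext mcoeff_inject)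

definition splits :: "(nat \<Rightarrow>\<^sub>0 nat) \<Rightarrow> ((nat \<Rightarrow>\<^sub>0 nat) \<times> (nat \<Rightarrow>\<^sub>0 nat)) set" where
  "splits \<mu> = {(\<alpha>, \<beta>). \<alpha> + \<beta> = \<mu>}"

lemma finite_splits [simp]: "finite (splits \<mu>)"
proof -
  let ?K = "Poly_Mapping.keys \<mu>"
  let ?F = "{f. \<forall>x. (x \<in> ?K \<longrightarrow> f x \<in> {..\<Sum>i\<in>?K. Poly_Mapping.lookup \<mu> i})
                 \<and> (x \<notin> ?K \<longrightarrow> f x = (0::nat))}"
  have fin: "finite ?F"
    by (rule finite_set_of_finite_funs) auto
  have mem: "Poly_Mapping.lookup \<alpha> \<in> ?F" if "\<alpha> + \<beta> = \<mu>" for \<alpha> \<beta>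
  proof -
    have le: "Poly_Mapping.lookup \<alpha> x \<le> Poly_Mapping.lookup \<mu> x" for x
      unfolding that[symmetric] lookup_add by (rule le_add1)
    have "Poly_Mapping.lookup \<alpha> x \<le> (\<Sum>i\<in>?K. Poly_Mapping.lookup \<mu> i)" if "x \<in> ?K" for x
      by (rule order_trans[OF le]) (intro member_le_sum that finite_keys zero_le)
    moreover have "Poly_Mapping.lookup \<alpha> x = 0" if "x \<notin> ?K" for x
      using le[of x] that by (simp add: in_keys_iff)
    ultimately show ?thesis
      by blast
  qed
  let ?h = "\<lambda>p. (Poly_Mapping.lookup (fst p), Poly_Mapping.lookup (snd p))"
  have "?h p \<in> ?F \<times> ?F" if "p \<in> splits \<mu>" for p
  proof (rule SigmaI)
    have "fst p + snd p = \<mu>"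
      using that by (auto simp: splits_def)
    then show "Poly_Mapping.lookup (fst p) \<in> ?F" "Poly_Mapping.lookup (snd p) \<in> ?F"
      using mem[of "fst p" "snd p"] mem[of "snd p" "fst p"] by (simp_all only: add.commute)
  qed
  then have "?h ` splits \<mu> \<subseteq> ?F \<times> ?F"
    by blast
  moreover have "inj_on ?h (splits \<mu>)"
    by (rule inj_onI) (simp add: prod_eq_iff lookup_inject)
  ultimately show ?thesis
    using fin by (meson finite_SigmaI finite_imageD finite_subset)
qed

instantiation mfps :: (comm_ring_1) comm_ring_1
begin

definition "0 = Abs_mfps (\<lambda>_. 0)"
definition "1 = Abs_mfps (\<lambda>\<mu>. if \<mu> = 0 then 1 else 0)"
definition "f + g = Abs_mfps (\<lambda>\<mu>. mcoeff f \<mu> + mcoeff g \<mu>)"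
definition "f - g = Abs_mfps (\<lambda>\<mu>. mcoeff f \<mu> - mcoeff g \<mu>)"
definition "- f = Abs_mfps (\<lambda>\<mu>. - mcoeff f \<mu>)"
definition "f * g = Abs_mfps (\<lambda>\<mu>. \<Sum>(\<alpha>, \<beta>)\<in>splits \<mu>. mcoeff f \<alpha> * mcoeff g \<beta>)"

instance
proof
  fix f g h :: "'a mfps"
  have mult: "mcoeff (f * g) \<mu> = (\<Sum>(\<alpha>, \<beta>)\<in>splits \<mu>. mcoeff f \<alpha> * mcoeff g \<beta>)" for f g :: "'a mfps" and \<mu>
    by (simp add: times_mfps_def)
  show "f * g * h = f * (g * h)"
  proof (rule mfps_eqI)
    fix \<mu>
    have "mcoeff (f * g * h) \<mu> =
        (\<Sum>p\<in>splits \<mu>. \<Sum>q\<in>splits (fst p). mcoeff f (fst q) * mcoeff g (snd q) * mcoeff h (snd p))"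
      by (simp add: mult case_prod_beta sum_distrib_right)
    also have "\<dots> = (\<Sum>(p, q)\<in>(SIGMA p:splits \<mu>. splits (fst p)).
        mcoeff f (fst q) * mcoeff g (snd q) * mcoeff h (snd p))"
      by (subst sum.Sigma) auto
    also have "\<dots> = (\<Sum>(p, q)\<in>(SIGMA p:splits \<mu>. splits (snd p)).
        mcoeff f (fst p) * (mcoeff g (fst q) * mcoeff h (snd q)))"
      by (rule sum.reindex_bij_witness[where
            i = "\<lambda>(p, q). ((fst p + fst q, snd q), (fst p, fst q))" and
            j = "\<lambda>(p, q). ((fst q, snd q + snd p), (snd q, snd p))"])
         (auto simp: splits_def algebra_simps)
    also have "\<dots> =
        (\<Sum>p\<in>splits \<mu>. \<Sum>q\<in>splits (snd p). mcoeff f (fst p) * (mcoeff g (fst q) * mcoeff h (snd q)))"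
      by (subst sum.Sigma) auto
    also have "\<dots> = mcoeff (f * (g * h)) \<mu>"
      by (simp add: mult case_prod_beta sum_distrib_left)
    finally show "mcoeff (f * g * h) \<mu> = mcoeff (f * (g * h)) \<mu>" .
  qed
  show "f * g = g * f"
  proof (rule mfps_eqI)
    fix \<mu>
    show "mcoeff (f * g) \<mu> = mcoeff (g * f) \<mu>"
      unfolding mult
      by (rule sum.reindex_bij_witness[where i = prod.swap and j = prod.swap])
         (auto simp: splits_def algebra_simps)
  qed
  show "1 * f = f"
  proof (rule mfps_eqI)
    fix \<mu>
    have "mcoeff (1 * f) \<mu> = (\<Sum>p\<in>{(0, \<mu>)}. mcoeff 1 (fst p) * mcoeff f (snd p))"
      unfolding mult case_prod_beta
      by (intro sum.mono_neutral_right finite_splits) (auto simp: splits_def one_mfps_def)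
    then show "mcoeff (1 * f) \<mu> = mcoeff f \<mu>"
      by (simp add: one_mfps_def)
  qed
  show "(f + g) * h = f * h + g * h"
    by (rule mfps_eqI)
       (simp add: mult plus_mfps_def distrib_right sum.distrib case_prod_beta)
  show "(0 :: 'a mfps) \<noteq> 1"
  proof
    assume "(0 :: 'a mfps) = 1"
    then have "mcoeff (0 :: 'a mfps) 0 = mcoeff 1 0"
      by (rule arg_cong)
    then show False
      by (simp add: zero_mfps_def one_mfps_def)
  qed
qed (rule mfps_eqI; simp add: plus_mfps_def minus_mfps_def uminus_mfps_def zero_mfps_def add_ac)+

end

lemma mcoeff_simps [simp]:
  "mcoeff 0 \<mu> = 0"
  "mcoeff 1 \<mu> = (if \<mu> = 0 then 1 else 0)"
  "mcoeff (f + g) \<mu> = mcoeff f \<mu> + mcoeff g \<mu>"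
  "mcoeff (f - g) \<mu> = mcoeff f \<mu> - mcoeff g \<mu>"
  "mcoeff (- f) \<mu> = - mcoeff f \<mu>"
  by (simp_all add: zero_mfps_def one_mfps_def plus_mfps_def minus_mfps_def uminus_mfps_def)

lemma mcoeff_mult:
  "mcoeff (f * g) \<mu> = (\<Sum>(\<alpha>, \<beta>)\<in>splits \<mu>. mcoeff f \<alpha> * mcoeff g \<beta>)"
  by (simp add: times_mfps_def)

text \<open>
  Division is multiplication by the ring inverse. As in the library, a non-unit gets the
  inverse \<^term>\<open>0\<close>; \<open>mfps_divide_iff\<close>, \<open>mfps_dvd_one\<close> and \<open>mfps_one_minus_X_dvd_one\<close> show
  that this is genuine division for denominators with constant coefficient $1$.
\<close>

instantiation mfps :: (comm_ring_1) inverse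
begin

definition "inverse f = (if f dvd 1 then THE g. f * g = 1 else (0 :: 'a mfps))"
definition "f div g = f * inverse (g :: 'a mfps)"

instance ..

end

lemma mfps_right_inverse:
  fixes f :: "'a :: comm_ring_1 mfps"
  assumes "f dvd 1"
  shows "f * inverse f = 1"
proof -
  obtain g where g: "f * g = 1"
    using assms by (metis dvdE)
  have "h = g" if "f * h = 1" for h
  proof -
    have "h = (f * g) * h"
      by (simp only: g mult_1_left)
    also have "\<dots> = g * (f * h)"
      by (simp only: mult_ac)
    finally show ?thesis
      by (simp only: that mult_1_right)
  qed
  then have "(THE h. f * h = 1) = g"
    using g by (intro the_equality)
  then show ?thesis
    by (simp only: inverse_mfps_def assms if_True g)
qed

lemma mfps_divide_iff:
  fixes f :: "'a :: comm_ring_1 mfps"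
  assumes "f dvd 1"
  shows "g = h / f \<longleftrightarrow> f * g = h"
proof
  assume "g = h / f"
  then have "f * g = h * (f * inverse f)"
    by (simp only: divide_mfps_def mult_ac)
  then show "f * g = h"
    by (simp only: mfps_right_inverse[OF assms] mult_1_right)
next
  assume "f * g = h"
  then have "h / f = f * g * inverse f"
    by (simp only: divide_mfps_def)
  also have "\<dots> = g * (f * inverse f)"
    by (simp only: mult_ac)
  finally show "g = h / f"
    by (simp only: mfps_right_inverse[OF assms] mult_1_right)
qed

definition total_degree :: "(nat \<Rightarrow>\<^sub>0 nat) \<Rightarrow> nat" where
  "total_degree \<mu> = (\<Sum>i\<in>Poly_Mapping.keys \<mu>. Poly_Mapping.lookup \<mu> i)"

lemma total_degree_add: "total_degree (\<alpha> + \<beta>) = total_degree \<alpha> + total_degree \<beta>"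
proof -
  let ?K = "Poly_Mapping.keys \<alpha> \<union> Poly_Mapping.keys \<beta>"
  have eq: "total_degree \<mu> = (\<Sum>i\<in>?K. Poly_Mapping.lookup \<mu> i)" if "Poly_Mapping.keys \<mu> \<subseteq> ?K" for \<mu>
    unfolding total_degree_def using that by (intro sum.mono_neutral_left) (auto simp: in_keys_iff)
  show ?thesis
    using eq[of "\<alpha> + \<beta>"] eq[of \<alpha>] eq[of \<beta>] keys_add[of \<alpha> \<beta>] by (simp add: lookup_add sum.distrib)
qed

lemma total_degree_eq_0: "total_degree \<mu> = 0 \<longleftrightarrow> \<mu> = 0"
  by (auto simp: total_degree_def in_keys_iff intro!: poly_mapping_eqI)

lemma mcoeff_power_eq_0:
  fixes u :: "'a :: comm_ring_1 mfps"
  assumes "mcoeff u 0 = 0" "total_degree \<mu> < n"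
  shows "mcoeff (u ^ n) \<mu> = 0"
  using assms(2)
proof (induction n arbitrary: \<mu>)
  case (Suc n)
  have "mcoeff u \<alpha> * mcoeff (u ^ n) \<beta> = 0" if "\<alpha> + \<beta> = \<mu>" for \<alpha> \<beta>
  proof (cases "\<alpha> = 0")
    case False
    then have "total_degree \<beta> < n"
      using that Suc.prems total_degree_add[of \<alpha> \<beta>] total_degree_eq_0[of \<alpha>] by simp
    then show ?thesis
      by (simp add: Suc.IH)
  qed (simp add: assms(1))
  then show ?case
    unfolding power_Suc mcoeff_mult splits_def by (intro sum.neutral) auto
qed simp

lemma mfps_dvd_one:
  fixes f :: "'a :: comm_ring_1 mfps"
  assumes "mcoeff f 0 = 1"
  shows "f dvd 1"
proof (rule dvdI)
  define u where "u = 1 - f"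
  have u0: "mcoeff u 0 = 0"
    by (simp add: u_def assms)
  have coeff_sum: "mcoeff (\<Sum>n\<le>N. u ^ n) \<nu> = (\<Sum>n\<le>N. mcoeff (u ^ n) \<nu>)" for N \<nu>
    by (induction N) auto
  define g where "g = Abs_mfps (\<lambda>\<nu>. \<Sum>n\<le>total_degree \<nu>. mcoeff (u ^ n) \<nu>)"
  show "1 = f * g"
  proof (rule mfps_eqI)
    fix \<mu>
    define N where "N = total_degree \<mu>"
    have eq: "mcoeff g \<beta> = mcoeff (\<Sum>n\<le>N. u ^ n) \<beta>" if "\<alpha> + \<beta> = \<mu>" for \<alpha> \<beta>
    proof -
      have "total_degree \<beta> \<le> N"
        using that total_degree_add[of \<alpha> \<beta>] by (simp add: N_def)
      then show ?thesis
        unfolding g_def coeff_sum mcoeff_Abs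
        by (intro sum.mono_neutral_left) (auto simp: mcoeff_power_eq_0[OF u0])
    qed
    have "mcoeff (f * g) \<mu> = mcoeff (f * (\<Sum>n\<le>N. u ^ n)) \<mu>"
      unfolding mcoeff_mult by (rule sum.cong) (auto simp: splits_def eq)
    also have "f * (\<Sum>n\<le>N. u ^ n) = 1 - u ^ Suc N"
      using sum_gp_basic[of u N] by (simp add: u_def)
    also have "mcoeff (1 - u ^ Suc N) \<mu> = mcoeff 1 \<mu>"
      using mcoeff_power_eq_0[OF u0, of \<mu> "Suc N"] by (simp add: N_def del: power_Suc)
    finally show "mcoeff 1 \<mu> = mcoeff (f * g) \<mu>" ..
  qed
qed

definition X :: "nat \<Rightarrow> 'a :: comm_ring_1 mfps" where
  "X i = Abs_mfps (\<lambda>\<mu>. if \<mu> = Poly_Mapping.single i 1 then 1 else 0)"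

lemma mfps_one_minus_X_dvd_one: "1 - X i * f dvd 1"
proof (rule mfps_dvd_one)
  have "mcoeff (X i * f) 0 = 0"
    unfolding mcoeff_mult
  proof (intro sum.neutral ballI)
    fix p :: "(nat \<Rightarrow>\<^sub>0 nat) \<times> (nat \<Rightarrow>\<^sub>0 nat)"
    assume "p \<in> splits 0"
    then have "total_degree (fst p) + total_degree (snd p) = 0"
      by (auto simp: splits_def total_degree_eq_0 simp flip: total_degree_add)
    then have "fst p = 0"
      by (simp add: total_degree_eq_0)
    moreover have "(0 :: nat \<Rightarrow>\<^sub>0 nat) \<noteq> Poly_Mapping.single i 1"
      by (metis lookup_single_eq lookup_zero zero_neq_one)
    ultimately show "(case p of (\<alpha>, \<beta>) \<Rightarrow> mcoeff (X i) \<alpha> * mcoeff f \<beta>) = 0"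
      by (simp add: X_def case_prod_beta)
  qed
  then show "mcoeff (1 - X i * f) 0 = 1"
    by simp
qed

text \<open>
  \<open>omit S F\<close> is the series $F$ evaluated at the variables whose index is not in the finite
  set $S$, in increasing order of index: $x_j$ is replaced by $x_{e(j)}$, where
  $e(0) < e(1) < \cdots$ enumerates the complement of $S$. As long as $0 \notin S$ we have
  $e(0) = 0$, so that $e(j)$ is the $j$-th positive integer outside $S$.
\<close>

definition omit :: "nat set \<Rightarrow> 'a :: comm_ring_1 mfps \<Rightarrow> 'a mfps" where
  "omit S F = Abs_mfps (\<lambda>\<mu>.
     if Poly_Mapping.keys \<mu> \<inter> S = {}
     then mcoeff F (Poly_Mapping.map_key (enumerate (- S)) \<mu>)
     else 0)"

section \<open>Unimodal involutions\<close>

text \<open>Either of the two monotone parts may be trivial; they share the peak.\<close>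

definition unimodal :: "nat list \<Rightarrow> bool" where
  "unimodal xs \<longleftrightarrow> (\<exists>p. sorted_wrt (<) (take (Suc p) xs) \<and> sorted_wrt (>) (drop p xs))"

definition compositions :: "nat \<Rightarrow> nat list set" where
  "compositions m = {lam. length lam = m \<and> (\<forall>a\<in>set lam. 0 < a)}"

definition psum :: "nat list \<Rightarrow> nat \<Rightarrow> nat" where
  "psum lam i = sum_list (take i lam)"

text \<open>Segments are numbered from $0$, permutations act on $\{1,\ldots,n\}$.\<close>

definition segment :: "nat list \<Rightarrow> (nat \<Rightarrow> nat) \<Rightarrow> nat \<Rightarrow> nat list" where
  "segment lam \<pi> i = map \<pi> [Suc (psum lam i)..<Suc (psum lam (Suc i))]"

definition unimodal_involutions :: "nat list \<Rightarrow> (nat \<Rightarrow> nat) set" where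
  "unimodal_involutions lam =
     {\<pi>. \<pi> permutes {1..sum_list lam} \<and> inv \<pi> = \<pi> \<and> (\<forall>i<length lam. unimodal (segment lam \<pi> i))}"

definition unimodal_involutions_I :: "nat \<Rightarrow> nat list \<Rightarrow> (nat \<Rightarrow> nat) set" where
  "unimodal_involutions_I j lam =
     {\<pi> \<in> unimodal_involutions lam.
        (\<pi> 1 \<le> psum lam j \<and> sorted_wrt (>) (segment lam \<pi> 0)) \<or> \<pi> 1 > psum lam j}"

definition unimodal_involutions_D :: "nat \<Rightarrow> nat list \<Rightarrow> (nat \<Rightarrow> nat) set" where
  "unimodal_involutions_D j lam =
     {\<pi> \<in> unimodal_involutions lam. \<pi> 1 \<le> psum lam j \<and> sorted_wrt (>) (segment lam \<pi> 0)}"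

definition des :: "nat list \<Rightarrow> (nat \<Rightarrow> nat) \<Rightarrow> nat" where
  "des lam \<pi> = card ({i \<in> {1..<sum_list lam}. \<pi> i > \<pi> (Suc i)} - psum lam ` {1..<length lam})"

section \<open>Generating functions\<close>

text \<open>
  For fixed $x$-degree only finitely many permutations contribute, so the series live in
  $\mathbb{Z}[t][[x_1, x_2, \ldots]]$, where \<open>T\<close> is the indeterminate $t$.
\<close>

definition T :: "int poly mfps" where
  "T = Abs_mfps (\<lambda>\<mu>. if \<mu> = 0 then monom 1 1 else 0)"

text \<open>The exponent vector of $x^\lambda = x_1^{\lambda_1} \cdots x_k^{\lambda_k}$.\<close>

definition exponents :: "nat list \<Rightarrow> (nat \<Rightarrow>\<^sub>0 nat)" where
  "exponents lam = (\<Sum>i<length lam. Poly_Mapping.single (Suc i) (lam ! i))"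

text \<open>
  The series $\sum_{\lambda\in\Lambda_m}\sum_{\pi\in A(\lambda)} x^\lambda t^{\mathrm{des}_\lambda(\pi)}$,
  given by its coefficients; at most one $\lambda$ contributes to each of them.
\<close>

definition gen_series :: "nat \<Rightarrow> (nat list \<Rightarrow> (nat \<Rightarrow> nat) set) \<Rightarrow> int poly mfps" where
  "gen_series m A = Abs_mfps (\<lambda>\<mu>.
     \<Sum>lam | lam \<in> compositions m \<and> exponents lam = \<mu>. \<Sum>\<pi>\<in>A lam. monom 1 (des lam \<pi>))"

definition L :: "nat \<Rightarrow> int poly mfps" where
  "L m = gen_series m unimodal_involutions"

definition LI :: "nat \<Rightarrow> nat \<Rightarrow> int poly mfps" where
  "LI m j = gen_series m (unimodal_involutions_I j)"

definition LD :: "nat \<Rightarrow> nat \<Rightarrow> int poly mfps" where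
  "LD m j = gen_series m (unimodal_involutions_D j)"

end

theory Submission
  imports Defs
begin

text \<open>
  Let $\pi$ be a $\lambda$-unimodal involution with $\pi_1 = v$ in segment $i$. As $\pi_v = 1$ is
  minimal, $v$ is the first or last position of its segment. Removing the cycle of $1$ and $v$
  gives an involution for the composition with parts $1$ and $i$ decreased by one, where these
  parts may vanish. This can be undone for each choice of the end of segment $i$: in front of the
  remaining first segment, the value $v$ is admissible if the following value is larger than $v$,
  or if it is smaller than $v$ and the segment is decreasing, which creates one more descent.
  Hence, if $E_i$ counts the involutions with $\pi_1$ in segment $i$, then $E_i$ is $x_1 x_i$
  times the bracket in the recurrence of $L^k$ if $i \ge 2$, the terms outside the sum come from
  $E_1$, and $L^k$, $L^k_j - D^k_j$ are sums of the $E_i$. The decreasing case gives $D^k_i -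
  D^k_{i-1}$ likewise. For $D^k_1$ it gives $(1 - x_1^2 t^2) D^k_1 = x_1 (1 + x_1 t) L^{k-1}(\hat
  x_1)$, with a factor $1 + x_1 t$ to cancel.
\<close>

section \<open>Unimodal lists and descents\<close>

text \<open>The bracket for \<open>E_i\<close> sorts by what the removal leaves. If parts 1 and i
  both survive, the two ends of segment i give the terms with \<open>L_{i-1}^k\<close> (first
  position, weight 1) and \<open>t L_i^k\<close> (last position: the closing 1 follows something
  larger). The index differs because part i belongs to the positions before v, hence its numbers lie
  below v, only when v is its last position. In both, t = 1 + (t - 1) adds a correction for the
  involutions in D, which gain a descent right after v. If part i vanishes, its two ends coincide
  and one term remains. If part 1 vanishes, nothing follows v in its segment, no condition is left,
  and the two ends give (t + 1) L. If both vanish, a single unweighted L remains. The obstacle is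
  that these four kinds of terms live in different numbers of variables. Indexing every series by
  weak compositions with k parts turns a deleted variable into a zero part. The four kinds then have
  disjoint supports, and each recurrence becomes a case distinction for a single
  coefficient.\<close>

fun descents :: "nat list \<Rightarrow> nat" where
  "descents (x # y # xs) = (if x > y then 1 else 0) + descents (y # xs)"
| "descents _ = 0"

lemma descents_Cons:
  "descents (x # xs) = (if xs \<noteq> [] \<and> x > hd xs then 1 else 0) + descents xs"
  by (cases xs) auto

lemma descents_snoc:
  "descents (xs @ [x]) = descents xs + (if xs \<noteq> [] \<and> last xs > x then 1 else 0)"
  by (induction xs rule: descents.induct) auto

lemma descents_map:
  assumes "strict_mono f"
  shows "descents (map f xs) = descents xs"
  by (induction xs rule: descents.induct) (auto simp: strict_mono_less[OF assms])

lemma descents_Cons_less: "(\<And>x. x \<in> set xs \<Longrightarrow> m < x) \<Longrightarrow> descents (m # xs) = descents xs"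
  by (cases xs) (auto simp: descents_Cons dest: order.strict_implies_not_eq, force)

lemma sorted_wrt_map_strict_mono:
  fixes f :: "nat \<Rightarrow> nat"
  assumes "strict_mono f"
  shows "sorted_wrt (<) (map f xs) \<longleftrightarrow> sorted_wrt (<) xs"
    and "sorted_wrt (>) (map f xs) \<longleftrightarrow> sorted_wrt (>) xs"
  by (simp_all add: sorted_wrt_map strict_mono_less[OF assms])

lemma unimodal_map:
  assumes "strict_mono f"
  shows "unimodal (map f xs) \<longleftrightarrow> unimodal xs"
  by (simp add: unimodal_def take_map drop_map sorted_wrt_map_strict_mono[OF assms])

lemma unimodal_Nil [simp]: "unimodal []"
  by (simp add: unimodal_def)

text \<open>A peak at index 0 is the decreasing case; otherwise \<open>x\<close> opens the
  increasing part and the peak of \<open>xs\<close> sits one index earlier. This recursion replaces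
  the existential peak in the later inductions.\<close>

lemma unimodal_Cons:
  "unimodal (x # xs) \<longleftrightarrow> sorted_wrt (>) (x # xs) \<or> xs \<noteq> [] \<and> x < hd xs \<and> unimodal xs"
  (is "?L \<longleftrightarrow> ?R")
proof
  assume ?L
  then obtain p where p: "sorted_wrt (<) (take (Suc p) (x # xs))" "sorted_wrt (>) (drop p (x # xs))"
    by (auto simp: unimodal_def)
  show ?R
  proof (cases p)
    case 0
    then show ?thesis using p(2) by simp
  next
    case (Suc q)
    then show ?thesis
      using p by (cases xs) (auto simp: unimodal_def)
  qed
next
  assume ?R
  then show ?L
  proof (elim disjE conjE)
    assume "sorted_wrt (>) (x # xs)"
    then show ?L
      unfolding unimodal_def by (intro exI[of _ 0]) simp
  next
    assume x: "xs \<noteq> []" "x < hd xs" and "unimodal xs"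
    then obtain q where q: "sorted_wrt (<) (take (Suc q) xs)" "sorted_wrt (>) (drop q xs)"
      by (auto simp: unimodal_def)
    have "sorted_wrt (<) (take (Suc (Suc q)) (x # xs))"
      using x q(1) by (cases xs) auto
    then show ?L
      unfolding unimodal_def using q(2) by (intro exI[of _ "Suc q"]) simp
  qed
qed

lemma unimodal_if_decreasing: "sorted_wrt (>) xs \<Longrightarrow> unimodal xs"
  unfolding unimodal_def by (intro exI[of _ 0]) (cases xs; simp)

text \<open>A new minimum can always start the increasing part, or, in the next lemma, close the
  decreasing part. Hence placing 1 at an end puts no condition on its segment.\<close>

lemma unimodal_Cons_less:
  assumes "\<And>x. x \<in> set xs \<Longrightarrow> m < x"
  shows "unimodal (m # xs) \<longleftrightarrow> unimodal xs"
  using assms by (cases xs) (auto simp: unimodal_Cons)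

lemma unimodal_snoc_less:
  assumes "\<And>x. x \<in> set xs \<Longrightarrow> m < x"
  shows "unimodal (xs @ [m]) \<longleftrightarrow> unimodal xs"
  using assms
proof (induction xs)
  case (Cons x xs)
  then have "unimodal (xs @ [m]) \<longleftrightarrow> unimodal xs"
    by simp
  then show ?case
    using Cons.prems by (cases "xs = []") (auto simp: unimodal_Cons sorted_wrt_append hd_append)
qed (simp add: unimodal_Cons)

text \<open>An inner entry of a unimodal list has a smaller neighbour: its predecessor up to the
  peak, its successor after it.\<close>

lemma unimodal_min_at_end:
  assumes "unimodal xs" "m \<in> set xs" "\<And>x. x \<in> set xs \<Longrightarrow> m \<le> x"
  shows "hd xs = m \<or> last xs = m"
  using assms
proof (induction xs)
  case (Cons x xs)
  show ?case
  proof (cases "x = m \<or> xs = []")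
    case False
    then have m: "m \<in> set xs" and "m < x"
      using Cons.prems(2) Cons.prems(3)[of x] by auto
    from Cons.prems(1) consider "sorted_wrt (>) (x # xs)" | "x < hd xs" "unimodal xs"
      by (auto simp: unimodal_Cons)
    then show ?thesis
    proof cases
      case 1
      then have "sorted_wrt (>) (butlast xs @ [last xs])"
        using False by simp
      then have "\<forall>y\<in>set (butlast xs). y > last xs"
        unfolding sorted_wrt_append by simp
      moreover have "m \<in> set (butlast xs @ [last xs])"
        using m False by simp
      moreover have "m \<le> last xs"
        using Cons.prems(3) False by simp
      ultimately have "last xs = m"
        by auto
      then show ?thesis
        using False by simp
    next
      case 2
      then have "hd xs = m \<or> last xs = m"
        using Cons.IH Cons.prems(3) m by simp
      then show ?thesis
        using 2 \<open>m < x\<close> False by auto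
    qed
  qed (use Cons.prems in auto)
qed simp

section \<open>Segments\<close>

lemma part_pos: "0 \<notin> set lam \<Longrightarrow> i < length lam \<Longrightarrow> 0 < (lam ! i :: nat)"
  by (metis gr0I nth_mem)

lemma sum_list_pos: "0 \<notin> set lam \<Longrightarrow> lam \<noteq> [] \<Longrightarrow> 1 \<le> (sum_list lam :: nat)"
  by (cases lam) auto

lemma psum_0 [simp]: "psum lam 0 = 0"
  by (simp add: psum_def)

lemma psum_Suc: "i < length lam \<Longrightarrow> psum lam (Suc i) = psum lam i + lam ! i"
  by (simp add: psum_def take_Suc_conv_app_nth)

lemma psum_length [simp]: "psum lam (length lam) = sum_list lam"
  by (simp add: psum_def)

lemma psum_mono: "i \<le> j \<Longrightarrow> psum lam i \<le> psum lam j"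
proof (induction j rule: dec_induct)
  case (step j)
  then show ?case
    by (cases "j < length lam") (auto simp: psum_Suc, simp add: psum_def)
qed simp

lemma psum_le_sum_list: "psum lam i \<le> sum_list lam"
  using psum_mono[of i "max i (length lam)" lam] by (simp add: psum_def max_def split: if_splits)

lemma psum_strict_mono:
  assumes "0 \<notin> set lam" "i < j" "j \<le> length lam"
  shows "psum lam i < psum lam j"
proof -
  have "lam ! i \<noteq> 0"
    using assms by (metis nth_mem order_less_le_trans)
  then have "psum lam i < psum lam (Suc i)"
    using assms by (simp add: psum_Suc)
  also have "\<dots> \<le> psum lam j"
    using assms by (intro psum_mono) simp
  finally show ?thesis .
qed

lemma psum_pos: "0 \<notin> set lam \<Longrightarrow> 0 < j \<Longrightarrow> j \<le> length lam \<Longrightarrow> 0 < psum lam j"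
  using psum_strict_mono[of lam 0 j] by simp

text \<open>Together with \<open>psum_interval_unique\<close> this assigns a number to exactly one
  segment. It is applied to positions when descents are counted and to the value
  \<open>\<pi> 1\<close> when involutions are classified.\<close>

lemma psum_interval:
  assumes "0 < x" "x \<le> psum lam m"
  shows "\<exists>p<m. psum lam p < x \<and> x \<le> psum lam (Suc p)"
  using assms(2)
proof (induction m)
  case (Suc m)
  show ?case
  proof (cases "x \<le> psum lam m")
    case True
    then show ?thesis
      using Suc.IH by (meson less_SucI)
  next
    case False
    then show ?thesis
      using Suc.prems by (meson lessI not_le)
  qed
qed (use assms(1) in simp)

lemma psum_interval_unique:
  assumes "psum lam p < x" "x \<le> psum lam (Suc p)" "psum lam q < x" "x \<le> psum lam (Suc q)"
  shows "p = q"
proof (rule ccontr)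
  assume "p \<noteq> q"
  then consider "Suc p \<le> q" | "Suc q \<le> p"
    by linarith
  then show False
    by cases (use assms psum_mono[of "Suc p" q lam] psum_mono[of "Suc q" p lam] in auto)
qed

lemma length_segment: "i < length lam \<Longrightarrow> length (segment lam \<pi> i) = lam ! i"
  by (simp add: segment_def psum_Suc)

lemma segment_0: "lam \<noteq> [] \<Longrightarrow> segment lam \<pi> 0 = map \<pi> [1..<Suc (lam ! 0)]"
  by (simp add: segment_def psum_Suc)

text \<open>The interval is open at \<open>b\<close> because a descent at the last position would
  compare with an entry outside the list.\<close>

lemma descents_map_upt:
  "descents (map f [Suc a..<Suc b]) = card {i \<in> {a<..<b}. f i > f (Suc i)}"
proof (induction b)
  case (Suc b)
  show ?case
  proof (cases "a < b")
    case True
    have "{i \<in> {a<..<Suc b}. f i > f (Suc i)} =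
        (if f b > f (Suc b) then insert b else (\<lambda>A. A)) {i \<in> {a<..<b}. f i > f (Suc i)}"
      using True by (auto simp: less_Suc_eq)
    moreover have "[Suc a..<Suc (Suc b)] = [Suc a..<Suc b] @ [Suc b]"
      using True by simp
    ultimately show ?thesis
      using True Suc by (simp del: upt_Suc add: descents_snoc last_map)
  next
    case False
    then have "{i \<in> {a<..<Suc b}. f i > f (Suc i)} = {}"
      by auto
    then show ?thesis
      using False by (cases "a = b") auto
  qed
qed simp

lemma des_eq_sum_descents: "des lam \<pi> = (\<Sum>i<length lam. descents (segment lam \<pi> i))"
proof -
  let ?D = "\<lambda>i. {x \<in> {psum lam i<..<psum lam (Suc i)}. \<pi> x > \<pi> (Suc x)}"
  have "{x \<in> {1..<sum_list lam}. \<pi> x > \<pi> (Suc x)} - psum lam ` {1..<length lam} = (\<Union>i<length lam. ?D i)"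
  proof (intro equalityI subsetI)
    fix x
    assume x: "x \<in> {x \<in> {1..<sum_list lam}. \<pi> x > \<pi> (Suc x)} - psum lam ` {1..<length lam}"
    then obtain p where p: "p < length lam" "psum lam p < x" "x \<le> psum lam (Suc p)"
      using psum_interval[of x lam "length lam"] by auto
    \<comment> \<open>Segment ends are exactly the excluded positions; the end of the last segment
      is not in the list of exclusions but is out of range as a descent.\<close>
    have "x \<noteq> psum lam (Suc p)"
    proof
      assume eq: "x = psum lam (Suc p)"
      then have "Suc p \<noteq> length lam"
        using x by auto
      then have "x \<in> psum lam ` {1..<length lam}"
        using eq p by auto
      then show False
        using x by simp
    qed
    then have "x \<in> ?D p"
      using p x by auto
    then show "x \<in> (\<Union>i<length lam. ?D i)"
      using p by blast
  next
    fix x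
    assume "x \<in> (\<Union>i<length lam. ?D i)"
    then obtain p where p: "p < length lam" and x: "x \<in> ?D p"
      by blast
    have "x < sum_list lam"
      using x psum_le_sum_list[of lam "Suc p"] by auto
    moreover have "x \<noteq> psum lam q" for q
      using x psum_mono[of q p lam] psum_mono[of "Suc p" q lam] by (cases "q \<le> p") auto
    ultimately show "x \<in> {x \<in> {1..<sum_list lam}. \<pi> x > \<pi> (Suc x)} - psum lam ` {1..<length lam}"
      using x by auto
  qed
  then have "des lam \<pi> = card (\<Union>i<length lam. ?D i)"
    by (simp add: des_def)
  also have "\<dots> = (\<Sum>i<length lam. card (?D i))"
  proof (rule card_UN_disjoint)
    show "\<forall>i\<in>{..<length lam}. \<forall>j\<in>{..<length lam}. i \<noteq> j \<longrightarrow> ?D i \<inter> ?D j = {}"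
    proof (intro ballI impI)
      fix i j :: nat
      assume "i \<noteq> j"
      then show "?D i \<inter> ?D j = {}"
        using psum_interval_unique[of lam i _ j] by (fastforce dest: less_imp_le)
    qed
  qed auto
  finally show ?thesis
    by (simp only: segment_def descents_map_upt)
qed

text \<open>
  Removing $1$ and $\<pi>_1$ may leave empty parts. These are harmless: by means of \<open>cut\<close>, all
  notions are seen to be invariant under dropping them.
\<close>

fun cut :: "(nat \<Rightarrow> 'a) \<Rightarrow> nat list \<Rightarrow> 'a list list" where
  "cut f [] = []"
| "cut f (a # lam) = map f [1..<Suc a] # cut (\<lambda>x. f (a + x)) lam"

lemma cut_eq_segments: "cut \<pi> lam = map (segment lam \<pi>) [0..<length lam]"
proof (induction lam arbitrary: \<pi>)
  case (Cons a lam)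
  have "segment (a # lam) \<pi> (Suc i) = segment lam (\<lambda>x. \<pi> (a + x)) i" for i
    by (rule nth_equalityI) (simp_all add: segment_def psum_def del: upt_Suc add: algebra_simps)
  then have "map (segment (a # lam) \<pi>) [0..<length (a # lam)] =
      segment (a # lam) \<pi> 0 # map (segment lam (\<lambda>x. \<pi> (a + x))) [0..<length lam]"
    by (simp only: length_Cons map_upt_Suc)
  moreover have "segment (a # lam) \<pi> 0 = map \<pi> [1..<Suc a]"
    by (simp add: segment_def psum_def)
  ultimately show ?case
    by (simp only: Cons.IH cut.simps)
qed simp

text \<open>A zero part contributes an empty block and shifts nothing after it. The recursion of
  \<open>cut\<close> shows this directly, whereas \<open>segment\<close> refers to parts by their
  index, which changes under filtering.\<close>

lemma cut_filter: "cut f (filter ((<) 0) lam) = filter (\<lambda>xs. xs \<noteq> []) (cut f lam)"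
  by (induction lam arbitrary: f) (auto simp del: upt_Suc)

lemma all_unimodal_iff_cut:
  "(\<forall>i<length lam. unimodal (segment lam \<pi> i)) \<longleftrightarrow> (\<forall>xs\<in>set (cut \<pi> lam). unimodal xs)"
  by (auto simp: cut_eq_segments)

lemma des_eq_cut: "des lam \<pi> = sum_list (map descents (cut \<pi> lam))"
  by (simp add: des_eq_sum_descents cut_eq_segments interv_sum_list_conv_sum_set_nat atLeast0LessThan
      comp_def)

lemma unimodal_involutions_filter:
  "unimodal_involutions (filter ((<) 0) lam) = unimodal_involutions lam"
proof -
  have "sum_list (filter ((<) 0) lam) = sum_list lam"
    by (induction lam) auto
  then show ?thesis
    unfolding unimodal_involutions_def all_unimodal_iff_cut cut_filter by auto
qed

lemma des_filter: "des (filter ((<) 0) lam) \<pi> = des lam \<pi>"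
proof -
  have "sum_list (map descents (filter (\<lambda>xs. xs \<noteq> []) xss)) = sum_list (map descents xss)" for xss
    by (induction xss) auto
  then show ?thesis
    by (simp only: des_eq_cut cut_filter)
qed

text \<open>Zeros after the first \<open>p\<close> parts do not disturb the numbering of these
  parts. This is the situation when part \<open>p\<close> (counted from 0) vanishes, so that
  deleting the variable \<open>X (Suc p)\<close> keeps the index \<open>p\<close> of
  \<open>LI\<close> and \<open>LD\<close>.\<close>

lemma psum_filter:
  assumes "0 \<notin> set (take p lam)" "p \<le> length lam"
  shows "psum (filter ((<) 0) lam) p = psum lam p"
proof -
  have "filter ((<) 0) (take p lam @ drop p lam) = take p lam @ filter ((<) 0) (drop p lam)"
    unfolding filter_append using assms(1) by (metis filter_True gr0I)
  then have "take p (filter ((<) 0) lam) = take p lam"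
    using assms(2) by simp
  then show ?thesis
    by (simp add: psum_def)
qed

lemma segment_0_filter:
  assumes "lam \<noteq> []" "lam ! 0 \<noteq> 0"
  shows "segment (filter ((<) 0) lam) \<pi> 0 = segment lam \<pi> 0"
  using assms by (cases lam) (auto simp: segment_0)

lemma unimodal_involutions_I_filter:
  assumes "0 \<notin> set (take p lam)" "0 < p" "p \<le> length lam"
  shows "unimodal_involutions_I p (filter ((<) 0) lam) = unimodal_involutions_I p lam"
    and "unimodal_involutions_D p (filter ((<) 0) lam) = unimodal_involutions_D p lam"
proof -
  have "lam \<noteq> []" "lam ! 0 \<noteq> 0"
    using assms by (cases lam; cases p; auto)+
  then show "unimodal_involutions_I p (filter ((<) 0) lam) = unimodal_involutions_I p lam"
    and "unimodal_involutions_D p (filter ((<) 0) lam) = unimodal_involutions_D p lam"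
    unfolding unimodal_involutions_I_def unimodal_involutions_D_def unimodal_involutions_filter
    by (simp_all only: psum_filter[OF assms(1,3)] segment_0_filter[OF \<open>lam \<noteq> []\<close> \<open>lam ! 0 \<noteq> 0\<close>])
qed

section \<open>Inserting the orbit of 1 into an involution\<close>

text \<open>
  \<open>skip v\<close> enumerates the numbers other than $1$ and $v$ (and fixes $0$), \<open>rank v\<close> counts the
  positive ones among them up to a given bound.
\<close>

definition skip :: "nat \<Rightarrow> nat \<Rightarrow> nat" where
  "skip v x = (if x = 0 then 0 else if x + 1 < v \<or> v = 1 then x + 1 else x + 2)"

definition rank :: "nat \<Rightarrow> nat \<Rightarrow> nat" where
  "rank v y = (if y < v \<or> v = 1 then y - 1 else y - 2)"

text \<open>For \<open>v = 1\<close> the new orbit is a fixed point, for \<open>v \<ge> 2\<close> a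
  2-cycle. On all other numbers this is the old involution, conjugated by an order-preserving
  renaming.\<close>

definition insert_orbit :: "nat \<Rightarrow> (nat \<Rightarrow> nat) \<Rightarrow> nat \<Rightarrow> nat" where
  "insert_orbit v \<pi> x = (if x = 1 then v else if x = v then 1 else skip v (\<pi> (rank v x)))"

definition involutions :: "nat \<Rightarrow> (nat \<Rightarrow> nat) set" where
  "involutions n = {\<pi>. (\<forall>x. x \<notin> {1..n} \<longrightarrow> \<pi> x = x) \<and> (\<forall>x. \<pi> (\<pi> x) = x)}"

lemma permutes_involution_iff:
  "\<pi> permutes {1..n} \<and> inv \<pi> = \<pi> \<longleftrightarrow> \<pi> \<in> involutions n"
proof
  assume \<pi>: "\<pi> permutes {1..n} \<and> inv \<pi> = \<pi>"
  then have "\<pi> (\<pi> x) = x" for x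
    using permutes_inverses(1)[of \<pi> "{1..n}" x] by simp
  then show "\<pi> \<in> involutions n"
    using \<pi> unfolding involutions_def by (simp add: permutes_def)
next
  assume \<pi>: "\<pi> \<in> involutions n"
  then have inv: "\<pi> (\<pi> x) = x" for x
    by (simp add: involutions_def)
  have "\<exists>!x. \<pi> x = y" for y
    by (rule ex1I[of _ "\<pi> y"]) (use inv in auto)
  then have "\<pi> permutes {1..n}"
    using \<pi> by (simp add: permutes_def involutions_def)
  moreover have "inv \<pi> = \<pi>"
    using inv by (intro inv_unique_comp) (simp_all add: fun_eq_iff)
  ultimately show "\<pi> permutes {1..n} \<and> inv \<pi> = \<pi>"
    by simp
qed

lemma unimodal_involutions_eq:
  "unimodal_involutions lam =
    {\<pi> \<in> involutions (sum_list lam). \<forall>i<length lam. unimodal (segment lam \<pi> i)}"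
  by (auto simp: unimodal_involutions_def permutes_involution_iff[symmetric])

lemma finite_unimodal_involutions [simp]: "finite (unimodal_involutions lam)"
  by (rule finite_subset[OF _ finite_permutations[of "{1..sum_list lam}"]])
    (auto simp: unimodal_involutions_def)

lemma involutions_in_range:
  assumes "\<pi> \<in> involutions n" "x \<in> {1..n}"
  shows "\<pi> x \<in> {1..n}"
proof (rule ccontr)
  assume "\<pi> x \<notin> {1..n}"
  then have "\<pi> (\<pi> x) = \<pi> x"
    using assms(1) by (auto simp: involutions_def)
  then have "\<pi> x = x"
    using assms(1) by (simp add: involutions_def)
  then show False
    using \<open>\<pi> x \<notin> {1..n}\<close> assms(2) by simp
qed

lemma strict_mono_skip: "strict_mono (skip v)"
  by (rule strict_monoI) (auto simp: skip_def)

lemma skip_neq: "1 \<le> v \<Longrightarrow> skip v x \<noteq> 1" "1 \<le> v \<Longrightarrow> skip v x \<noteq> v"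
  by (auto simp: skip_def)

lemma rank_skip: "1 \<le> v \<Longrightarrow> rank v (skip v x) = x"
  by (auto simp: skip_def rank_def)

lemma skip_rank: "1 \<le> v \<Longrightarrow> x \<noteq> 1 \<Longrightarrow> x \<noteq> v \<Longrightarrow> skip v (rank v x) = x"
  by (auto simp: skip_def rank_def)

lemma skip_gt_1: "0 < x \<Longrightarrow> 1 < skip v x"
  by (auto simp: skip_def)

lemma skip_less_iff: "2 \<le> v \<Longrightarrow> 0 < x \<Longrightarrow> skip v x < v \<longleftrightarrow> x \<le> v - 2"
  by (auto simp: skip_def)

lemma rank_in_interval:
  "1 \<le> v \<Longrightarrow> v \<le> n \<Longrightarrow> x \<noteq> 1 \<Longrightarrow> x \<noteq> v \<Longrightarrow> rank v x \<in> {1..rank v n} \<longleftrightarrow> x \<in> {1..n}"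
  by (auto simp: rank_def split: if_splits)

lemma insert_orbit_skip: "1 \<le> v \<Longrightarrow> insert_orbit v \<pi> (skip v x) = skip v (\<pi> x)"
  using skip_neq[of v x] by (simp add: insert_orbit_def rank_skip)

lemma insert_orbit_1 [simp]: "insert_orbit v \<pi> 1 = v" "insert_orbit v \<pi> (Suc 0) = v"
  by (simp_all add: insert_orbit_def)

lemma insert_orbit_orbit: "insert_orbit v \<pi> v = 1"
  by (simp add: insert_orbit_def)

text \<open>An involution that sends 1 to \<open>v\<close> preserves the complement of
  \<open>{1, v}\<close>; renaming this complement by \<open>rank v\<close> inverts the insertion.
  The size \<open>rank v n\<close> is \<open>n - 1\<close> for \<open>v = 1\<close> and
  \<open>n - 2\<close> otherwise.\<close>

lemma bij_betw_insert_orbit: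
  assumes "1 \<le> v" "v \<le> n"
  shows "bij_betw (insert_orbit v) (involutions (rank v n)) {\<pi> \<in> involutions n. \<pi> 1 = v}"
proof (rule bij_betw_byWitness[where f' = "\<lambda>\<pi> x. rank v (\<pi> (skip v x))"])
  show "\<forall>\<pi>\<in>involutions (rank v n). (\<lambda>x. rank v (insert_orbit v \<pi> (skip v x))) = \<pi>"
    using assms by (simp add: insert_orbit_skip rank_skip)
  show "\<forall>\<pi>\<in>{\<pi> \<in> involutions n. \<pi> 1 = v}. insert_orbit v (\<lambda>x. rank v (\<pi> (skip v x))) = \<pi>"
  proof (intro ballI ext)
    fix \<pi> x
    assume \<pi>: "\<pi> \<in> {\<pi> \<in> involutions n. \<pi> 1 = v}"
    then have inv: "\<pi> (\<pi> y) = y" for y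
      by (simp add: involutions_def)
    show "insert_orbit v (\<lambda>x. rank v (\<pi> (skip v x))) x = \<pi> x"
    proof (cases "x = 1 \<or> x = v")
      case True
      then show ?thesis
        using \<pi> inv[of 1] by (auto simp: insert_orbit_def)
    next
      case False
      then have "\<pi> x \<noteq> 1" "\<pi> x \<noteq> v"
        using \<pi> inv[of 1] inv[of x] by auto
      then show ?thesis
        using False assms by (simp add: insert_orbit_def skip_rank)
    qed
  qed
  show "insert_orbit v ` involutions (rank v n) \<subseteq> {\<pi> \<in> involutions n. \<pi> 1 = v}"
  proof (rule image_subsetI)
    fix \<pi>
    assume \<pi>: "\<pi> \<in> involutions (rank v n)"
    have "insert_orbit v \<pi> (insert_orbit v \<pi> x) = x" for x
    proof (cases "x = 1 \<or> x = v")
      case True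
      then show ?thesis
        by (auto simp: insert_orbit_orbit)
    next
      case False
      then have "insert_orbit v \<pi> x = skip v (\<pi> (rank v x))"
        by (simp add: insert_orbit_def)
      then show ?thesis
        using \<pi> assms False by (simp add: insert_orbit_skip skip_rank involutions_def)
    qed
    moreover have "insert_orbit v \<pi> x = x" if "x \<notin> {1..n}" for x
    proof -
      have "x \<noteq> 1" "x \<noteq> v"
        using that assms by auto
      moreover from this have "\<pi> (rank v x) = rank v x"
        using \<pi> that assms rank_in_interval[of v n x] by (auto simp: involutions_def)
      ultimately show ?thesis
        using assms by (simp add: insert_orbit_def skip_rank)
    qed
    ultimately show "insert_orbit v \<pi> \<in> {\<pi> \<in> involutions n. \<pi> 1 = v}"
      by (simp add: involutions_def)
  qed
  show "(\<lambda>\<pi> x. rank v (\<pi> (skip v x))) ` {\<pi> \<in> involutions n. \<pi> 1 = v} \<subseteq> involutions (rank v n)"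
  proof (rule image_subsetI)
    fix \<pi>
    assume \<pi>: "\<pi> \<in> {\<pi> \<in> involutions n. \<pi> 1 = v}"
    then have inv: "\<pi> (\<pi> y) = y" for y
      by (simp add: involutions_def)
    \<comment> \<open>\<open>skip v\<close> undoes \<open>rank v\<close> only away from 1 and
      \<open>v\<close>, so the orbit has to be avoided before the two can be cancelled.\<close>
    have neq: "\<pi> (skip v x) \<noteq> 1" "\<pi> (skip v x) \<noteq> v" for x
      using \<pi> inv[of 1] inv[of "skip v x"] skip_neq[of v x] assms(1) by auto
    have "rank v (\<pi> (skip v x)) = x" if "x \<notin> {1..rank v n}" for x
    proof -
      have "skip v x \<notin> {1..n}"
        using that assms rank_in_interval[of v n "skip v x"] skip_neq[of v x]
        by (auto simp: rank_skip)
      then have "\<pi> (skip v x) = skip v x"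
        using \<pi> by (auto simp: involutions_def)
      then show ?thesis
        using assms by (simp add: rank_skip)
    qed
    moreover have "rank v (\<pi> (skip v (rank v (\<pi> (skip v x))))) = x" for x
      using assms neq by (simp add: skip_rank inv rank_skip)
    ultimately show "(\<lambda>x. rank v (\<pi> (skip v x))) \<in> involutions (rank v n)"
      by (simp add: involutions_def)
  qed
qed

text \<open>Consecutive positions stay consecutive after the orbit is deleted and the rest
  renumbered; this is why segments turn into segments.\<close>

lemma filter_upt_skip:
  assumes "1 \<le> v" "a \<le> b"
  shows "filter (\<lambda>x. x \<noteq> 1 \<and> x \<noteq> v) [Suc a..<Suc b] = map (skip v) [Suc (rank v a)..<Suc (rank v b)]"
  using assms(2)
proof (induction b rule: dec_induct)
  case (step b)
  have "rank v a \<le> rank v b"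
    using step.hyps by (auto simp: rank_def)
  show ?case
  proof (cases "Suc b = 1 \<or> Suc b = v")
    case True
    then have "rank v (Suc b) = rank v b"
      using assms(1) by (auto simp: rank_def)
    then show ?thesis
      using True step by auto
  next
    case False
    then have "rank v (Suc b) = Suc (rank v b)" "skip v (Suc (rank v b)) = Suc b"
      using assms(1) by (auto simp: rank_def skip_def)
    then show ?thesis
      using False step \<open>rank v a \<le> rank v b\<close> by auto
  qed
qed simp

section \<open>Effect of inserting the orbit on segments, unimodality and descents\<close>

definition decr :: "nat \<Rightarrow> nat list \<Rightarrow> nat list" where
  "decr j lam = lam[j := lam ! j - 1]"

lemma length_decr [simp]: "length (decr j lam) = length lam"
  by (simp add: decr_def)

lemma nth_decr: "i < length lam \<Longrightarrow> decr j lam ! i = (if i = j then lam ! i - 1 else lam ! i)"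
  by (simp add: decr_def)

lemma psum_decr:
  assumes "j < length lam" "0 < lam ! j"
  shows "psum (decr j lam) i = (if j < i then psum lam i - 1 else psum lam i)"
proof -
  have "psum (decr j lam) i + (if j < i then 1 else 0) = psum lam i" if "i \<le> length lam" for i
    using that
  proof (induction i)
    case (Suc i)
    then show ?case
      using assms by (auto simp: psum_Suc nth_decr)
  qed simp
  from this[of i] this[of "length lam"] show ?thesis
    using assms by (cases "i \<le> length lam") (auto simp: psum_def split: if_splits)
qed

text \<open>The orbit meets a segment only at its ends, in \<open>ps\<close> and \<open>rs\<close>.
  The middle positions \<open>qs\<close> are those kept by \<open>filter_upt_skip\<close>, and on
  them the new involution is the old one renamed by \<open>skip v\<close>.\<close>

lemma segment_insert_orbit:
  assumes "1 \<le> v" and psum': "\<And>i. i \<le> length lam \<Longrightarrow> psum lam' i = rank v (psum lam i)"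
    and i: "i < length lam" and eq: "[Suc (psum lam i)..<Suc (psum lam (Suc i))] = ps @ qs @ rs"
    and orb: "set ps \<subseteq> {1, v}" "set rs \<subseteq> {1, v}" "1 \<notin> set qs" "v \<notin> set qs"
  shows "segment lam (insert_orbit v \<pi>) i =
    map (insert_orbit v \<pi>) ps @ map (skip v) (segment lam' \<pi> i) @ map (insert_orbit v \<pi>) rs"
proof -
  have "qs = filter (\<lambda>x. x \<noteq> 1 \<and> x \<noteq> v) (ps @ qs @ rs)"
  proof -
    have "filter (\<lambda>x. x \<noteq> 1 \<and> x \<noteq> v) ps = []" "filter (\<lambda>x. x \<noteq> 1 \<and> x \<noteq> v) rs = []"
      using orb by (auto simp: filter_empty_conv)
    moreover have "filter (\<lambda>x. x \<noteq> 1 \<and> x \<noteq> v) qs = qs"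
      using orb by (auto simp: filter_id_conv)
    ultimately show ?thesis
      by simp
  qed
  also have "\<dots> = map (skip v) [Suc (psum lam' i)..<Suc (psum lam' (Suc i))]"
    using assms(1) i by (simp only: eq[symmetric] filter_upt_skip psum_mono psum' Suc_leI less_imp_le)
  finally have "map (insert_orbit v \<pi>) qs = map (skip v) (segment lam' \<pi> i)"
    using assms(1) by (simp add: segment_def insert_orbit_skip)
  then show ?thesis
    by (simp only: segment_def eq map_append)
qed

text \<open>Exactly the old values 1 to \<open>v - 2\<close> are renamed to numbers below
  \<open>v\<close>. With \<open>v - 2\<close> in the role of \<open>psum lam r\<close>, the
  condition on \<open>hd xs\<close> is that of \<open>unimodal_involutions_I\<close>.\<close>

lemma unimodal_Cons_skip_iff:
  assumes "2 \<le> v" "\<And>x. x \<in> set xs \<Longrightarrow> 0 < x"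
  shows "unimodal (v # map (skip v) xs) \<longleftrightarrow>
    unimodal xs \<and> (xs \<noteq> [] \<longrightarrow> hd xs \<le> v - 2 \<and> sorted_wrt (>) xs \<or> hd xs > v - 2)"
proof (cases xs)
  case (Cons y ys)
  have "sorted_wrt (>) (v # map (skip v) xs) \<longleftrightarrow> skip v y < v \<and> sorted_wrt (>) xs"
    using Cons strict_mono_less[OF strict_mono_skip, of v]
    by (auto simp: sorted_wrt_map) (meson order.strict_trans)
  moreover have "skip v y \<noteq> v"
    using skip_neq[of v y] assms(1) by simp
  then have "v < skip v y \<longleftrightarrow> \<not> skip v y < v"
    by linarith
  moreover have "skip v y < v \<longleftrightarrow> y \<le> v - 2"
    using Cons assms by (intro skip_less_iff) auto
  ultimately show ?thesis
    unfolding unimodal_Cons[of v] unimodal_map[OF strict_mono_skip]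
    using Cons unimodal_if_decreasing[of xs] by auto
qed (simp add: unimodal_Cons)

lemma descents_Cons_skip:
  assumes "2 \<le> v" "\<And>x. x \<in> set xs \<Longrightarrow> 0 < x"
  shows "descents (v # map (skip v) xs) = descents xs + (if xs \<noteq> [] \<and> hd xs \<le> v - 2 then 1 else 0)"
  unfolding descents_Cons[of v] descents_map[OF strict_mono_skip]
  using assms by (cases xs) (auto simp: skip_less_iff)

lemma hd_segment_0: "lam \<noteq> [] \<Longrightarrow> 0 < lam ! 0 \<Longrightarrow> hd (segment lam \<pi> 0) = \<pi> 1"
  by (simp add: segment_0 upt_conv_Cons del: upt_Suc)

lemma segment_positive:
  assumes "\<pi> \<in> involutions (sum_list lam)" "x \<in> set (segment lam \<pi> i)"
  shows "0 < x"
proof -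
  obtain y where y: "x = \<pi> y" "y \<in> {1..psum lam (Suc i)}"
    using assms(2) by (auto simp: segment_def)
  then have "y \<in> {1..sum_list lam}"
    using psum_le_sum_list[of lam "Suc i"] by auto
  then show ?thesis
    using involutions_in_range[OF assms(1)] y(1) by force
qed

text \<open>The value $1$ at position $\<pi>_1$ is the minimum of a unimodal segment.\<close>

lemma orbit_of_1_at_segment_end:
  assumes \<pi>: "\<pi> \<in> unimodal_involutions lam" and j: "j < length lam"
    and v: "psum lam j < \<pi> 1" "\<pi> 1 \<le> psum lam (Suc j)"
  shows "\<pi> 1 = Suc (psum lam j) \<or> \<pi> 1 = psum lam (Suc j)"
proof -
  let ?s = "segment lam \<pi> j"
  have inv: "\<pi> \<in> involutions (sum_list lam)" and uni: "unimodal ?s"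
    using \<pi> j by (auto simp: unimodal_involutions_eq)
  have invol: "\<pi> (\<pi> x) = x" for x
    using inv by (simp add: involutions_def)
  have "1 \<in> set ?s"
    using v invol[of 1] by (auto simp: segment_def image_iff simp del: upt_Suc intro!: bexI[of _ "\<pi> 1"])
  moreover have "1 \<le> x" if "x \<in> set ?s" for x
    using segment_positive[OF inv that] by simp
  ultimately have "hd ?s = 1 \<or> last ?s = 1"
    using unimodal_min_at_end[OF uni] by blast
  moreover have "hd ?s = \<pi> (Suc (psum lam j))" "last ?s = \<pi> (psum lam (Suc j))"
    using v by (simp_all add: segment_def hd_map last_map del: upt_Suc)
  ultimately show ?thesis
    using invol by metis
qed

text \<open>
  In the lemma below \<open>1\<close> is placed at the first (if \<open>\<not> e\<close>) or last (if \<open>e\<close>) position of segment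
  \<open>j\<close>. The case of a part \<open>1\<close> counts as first position.
\<close>

lemma insert_orbit_unimodal:
  fixes e :: bool
  assumes pos: "0 \<notin> set lam" and j: "j < length lam"
    and e': "if e then 2 \<le> lam ! j else 0 < j"
    and v: "v = (if e then psum lam (Suc j) else Suc (psum lam j))"
    and lam': "lam' = decr j (decr 0 lam)" and r: "r = (if e then Suc j else j)"
    and \<pi>': "\<pi>' \<in> involutions (sum_list lam')" and \<pi>: "\<pi> = insert_orbit v \<pi>'"
  shows "(\<forall>i<length lam. unimodal (segment lam \<pi> i)) \<longleftrightarrow>
      (\<forall>i<length lam'. unimodal (segment lam' \<pi>' i)) \<and>
      (0 < lam' ! 0 \<longrightarrow> \<pi>' 1 \<le> psum lam' r \<and> sorted_wrt (>) (segment lam' \<pi>' 0) \<or> \<pi>' 1 > psum lam' r)"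
      (is ?uni)
    and "des lam \<pi> = des lam' \<pi>' + (if e then 1 else 0) + (if 0 < lam' ! 0 \<and> \<pi>' 1 \<le> psum lam' r then 1 else 0)"
      (is ?des)
    and "sorted_wrt (>) (segment lam \<pi> 0) \<longleftrightarrow>
      sorted_wrt (>) (segment lam' \<pi>' 0) \<and> (0 < lam' ! 0 \<longrightarrow> \<pi>' 1 \<le> psum lam' r)" (is ?dec)
    and "2 \<le> v" "v \<le> sum_list lam" "rank v (sum_list lam) = sum_list lam'"
proof -
  have e: "e \<Longrightarrow> 2 \<le> lam ! j" "\<not> e \<Longrightarrow> 0 < j"
    using e' by simp_all
  have ne: "lam \<noteq> []"
    using j by auto
  note part_pos = part_pos[OF pos]
  have "0 < psum lam j" if "\<not> e"
    using psum_pos[OF pos e(2)[OF that]] j by simp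
  then show v2: "2 \<le> v"
    using e j by (auto simp: v psum_Suc)
  then have v1: "1 \<le> v"
    by simp
  \<comment> \<open>For \<open>j = 0\<close> both positions are taken from the same part. Then
    \<open>e\<close> holds and that part has size at least 2.\<close>
  have dj: "0 < decr 0 lam ! j"
    unfolding nth_decr[OF j] using part_pos[OF j] e by (cases e) auto
  have len: "length lam' = length lam"
    by (simp add: lam')
  have v_bounds: "psum lam j < v" "v \<le> psum lam (Suc j)"
    using part_pos[OF j] by (auto simp: v psum_Suc j)
  then show "v \<le> sum_list lam"
    using psum_le_sum_list order_trans by blast
  \<comment> \<open>Both sides count the positions in the first \<open>i\<close> parts other than 1,
    which lies in part 0, and \<open>v\<close>, which lies in part \<open>j\<close>.\<close>
  have psum': "psum lam' i = rank v (psum lam i)" if "i \<le> length lam" for i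
  proof -
    have "psum lam' i = psum lam i - (if 0 < i then 1 else 0) - (if j < i then 1 else 0)"
      unfolding lam' using dj part_pos[of 0] ne j by (auto simp: psum_decr)
    moreover have "psum lam i < v \<longleftrightarrow> i \<le> j"
      using v_bounds psum_mono[of i j lam] psum_mono[of "Suc j" i lam]
      by (cases "i \<le> j") (auto simp: v)
    moreover have "i = 0" if "psum lam i = 0"
      using psum_pos[OF pos, of i] that \<open>i \<le> length lam\<close> by auto
    ultimately show ?thesis
      using v2 by (cases "i = 0") (auto simp: rank_def)
  qed
  from psum'[of "length lam"] show "rank v (sum_list lam) = sum_list lam'"
    by (metis len order_refl psum_length)
  \<comment> \<open>The first \<open>r\<close> parts of \<open>lam\<close> end at \<open>v\<close>
    if \<open>e\<close> holds and just before \<open>v\<close> otherwise. Without the orbit,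
    \<open>v - 2\<close> positions remain either way, which is the threshold of
    \<open>unimodal_Cons_skip_iff\<close>.\<close>
  have "psum lam' r = v - 2"
    using psum'[of r] j v2 by (auto simp: r v rank_def)
  have s_pos: "0 < x" if "x \<in> set (segment lam' \<pi>' i)" for x i
    using segment_positive[OF \<pi>' that] .
  have s_gt: "1 < x" if "x \<in> set (map (skip v) (segment lam' \<pi>' i))" for x i
    using that s_pos skip_gt_1 by fastforce
  let ?s = "\<lambda>i. segment lam' \<pi>' i"
  \<comment> \<open>These are values: \<open>v\<close> stands at position 1 and 1 at position
    \<open>v\<close>. They never both stand in front, because \<open>\<not> e\<close> forces
    \<open>0 < j\<close>.\<close>
  define front where "front i = (if i = 0 then [v] else []) @ (if i = j \<and> \<not> e then [1] else [])" for i
  define rear where "rear i = (if i = j \<and> e then [1::nat] else [])" for i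
  have seg: "segment lam \<pi> i = front i @ map (skip v) (?s i) @ rear i" if i: "i < length lam" for i
  proof -
    let ?a = "psum lam i" and ?b = "psum lam (Suc i)"
    have ab: "?b = ?a + lam ! i" "0 < lam ! i"
      using i part_pos by (auto simp: psum_Suc)
    have a0: "?a = 0 \<longleftrightarrow> i = 0"
      using psum_pos[OF pos, of i] i by (cases "i = 0") auto
    have vi: "i = j" if "?a < v" "v \<le> ?b"
      using psum_interval_unique[OF that v_bounds] .
    \<comment> \<open>Now positions: \<open>ps\<close> and \<open>rs\<close> are the orbit positions
      in segment \<open>i\<close>, mapped by \<open>\<pi>\<close> to \<open>front i\<close> and
      \<open>rear i\<close>; \<open>[lo..<hi]\<close> is the rest.\<close>
    define lo where "lo = Suc ?a + (if i = 0 then 1 else 0) + (if i = j \<and> \<not> e then 1 else 0)"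
    define hi where "hi = Suc ?b - (if i = j \<and> e then 1 else 0)"
    define ps where "ps = (if i = 0 then [1] else []) @ (if i = j \<and> \<not> e then [v] else [])"
    define rs where "rs = (if i = j \<and> e then [v] else [])"
    have "[Suc ?a..<Suc ?b] = ps @ [lo..<hi] @ rs"
    proof -
      have "[Suc ?a..<Suc ?b] = ps @ [lo..<Suc ?b]"
        using ab a0 e(2) by (auto simp: ps_def lo_def v upt_conv_Cons simp del: upt_Suc)
      moreover have "[lo..<Suc ?b] = [lo..<hi] @ rs"
        using ab e(1) by (auto simp: lo_def hi_def rs_def v)
      ultimately show ?thesis
        by simp
    qed
    moreover have "1 \<notin> set [lo..<hi]"
      using a0 by (cases "i = 0") (auto simp: lo_def)
    moreover have "v \<notin> set [lo..<hi]"
    proof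
      assume "v \<in> set [lo..<hi]"
      then have lohi: "lo \<le> v" "v < hi"
        by auto
      have "i = j"
        by (rule vi) (use lohi in \<open>simp_all add: lo_def hi_def\<close>)
      then show False
        using lohi v by (cases e) (simp_all add: lo_def hi_def)
    qed
    moreover have "set ps \<subseteq> {1, v}" "set rs \<subseteq> {1, v}"
      by (auto simp: ps_def rs_def)
    ultimately have "segment lam \<pi> i = map \<pi> ps @ map (skip v) (?s i) @ map \<pi> rs"
      unfolding \<pi> by (intro segment_insert_orbit[OF v1 psum' i])
    moreover have "map \<pi> ps = front i" "map \<pi> rs = rear i"
      by (auto simp: \<pi> ps_def front_def rs_def rear_def insert_orbit_orbit)
    ultimately show ?thesis
      by simp
  qed
  have "lam' \<noteq> []"
    using ne len by auto
  then have s0: "0 < lam' ! 0 \<Longrightarrow> hd (?s 0) = \<pi>' 1"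
    by (rule hd_segment_0)
  have s0_ne: "?s 0 \<noteq> [] \<longleftrightarrow> 0 < lam' ! 0"
    using length_segment[of 0 lam' \<pi>'] \<open>lam' \<noteq> []\<close> by (metis length_greater_0_conv)
  have rear: "unimodal (xs @ rear i) \<longleftrightarrow> unimodal xs" if "\<And>x. x \<in> set xs \<Longrightarrow> 1 < x" for xs i
    using unimodal_snoc_less[of xs 1] that by (auto simp: rear_def)
  have v_s_gt: "1 < x" if "x \<in> set (v # map (skip v) (?s 0))" for x
    using that s_gt[of x 0] v2 by auto
  have uni_0: "unimodal (segment lam \<pi> 0) \<longleftrightarrow> unimodal (v # map (skip v) (?s 0))"
  proof -
    have "segment lam \<pi> 0 = (v # map (skip v) (?s 0)) @ rear 0"
      using e(2) ne by (auto simp: seg front_def)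
    then show ?thesis
      by (simp only: rear[OF v_s_gt])
  qed
  have uni_Suc: "unimodal (segment lam \<pi> i) \<longleftrightarrow> unimodal (?s i)" if "0 < i" "i < length lam" for i
  proof -
    have "unimodal (segment lam \<pi> i) \<longleftrightarrow> unimodal (map (skip v) (?s i) @ rear i)"
      using unimodal_Cons_less[of "map (skip v) (?s i)" 1] s_gt that
      by (auto simp: seg front_def rear_def)
    also have "\<dots> \<longleftrightarrow> unimodal (map (skip v) (?s i))"
      using s_gt by (intro rear)
    finally show ?thesis
      by (simp add: unimodal_map strict_mono_skip)
  qed
  have all_split: "(\<forall>i<length lam. P i) \<longleftrightarrow> P 0 \<and> (\<forall>i. 0 < i \<and> i < length lam \<longrightarrow> P i)" for P
    using ne by (metis gr0I length_greater_0_conv)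
  show ?uni
    unfolding len all_split[of "\<lambda>i. unimodal (segment lam \<pi> i)"] all_split[of "\<lambda>i. unimodal (?s i)"] uni_0
    using uni_Suc unimodal_Cons_skip_iff[OF v2, of "?s 0"] s_pos s0 s0_ne \<open>psum lam' r = v - 2\<close> by auto
  have des: "descents (segment lam \<pi> i) = descents (?s i) + (if i = j \<and> e then 1 else 0) +
      (if i = 0 then (if 0 < lam' ! 0 \<and> \<pi>' 1 \<le> psum lam' r then 1 else 0) else 0)"
    if i: "i < length lam" for i
  proof -
    have "descents (xs @ rear i) = descents xs + (if i = j \<and> e then 1 else 0)"
      if "xs \<noteq> []" "\<And>x. x \<in> set xs \<Longrightarrow> 1 < x" for xs
      using that by (auto simp: rear_def descents_snoc)
    note db = this
    show ?thesis
    proof (cases "i = 0")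
      case True
      have "segment lam \<pi> 0 = (v # map (skip v) (?s 0)) @ rear i"
        using e(2) ne True by (auto simp: seg front_def)
      then show ?thesis
        using db[of "v # map (skip v) (?s 0)"] v_s_gt s0 s0_ne True
        by (auto simp: descents_Cons_skip[OF v2] s_pos \<open>psum lam' r = v - 2\<close>)
    next
      case False
      \<comment> \<open>The closing 1 creates a descent only if something precedes it;
        \<open>2 \<le> lam ! j\<close> guarantees this. In segment 0 the leading \<open>v\<close>
        does.\<close>
      have "?s i \<noteq> []" if "i = j" e
        using length_segment[of i lam' \<pi>'] e(1) that i False by (auto simp: lam' nth_decr)
      moreover have "descents (1 # map (skip v) (?s i)) = descents (?s i)"
        using descents_Cons_less[OF s_gt] by (simp only: descents_map strict_mono_skip)
      ultimately show ?thesis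
        using False db[of "map (skip v) (?s i)"] s_gt i
        by (auto simp: seg front_def rear_def descents_map strict_mono_skip)
    qed
  qed
  have "des lam \<pi> = (\<Sum>i<length lam. descents (?s i)) + (\<Sum>i<length lam. if i = j \<and> e then 1 else 0) +
      (\<Sum>i<length lam. if i = 0 then (if 0 < lam' ! 0 \<and> \<pi>' 1 \<le> psum lam' r then 1 else 0) else 0)"
    unfolding des_eq_sum_descents by (simp add: des sum.distrib)
  moreover have "(\<Sum>i<length lam. if i = j \<and> e then 1 else 0 :: nat) = (if e then 1 else 0)"
    using j by (cases e) auto
  ultimately show ?des
    using ne by (simp add: des_eq_sum_descents len)
  have "sorted_wrt (>) (segment lam \<pi> 0) \<longleftrightarrow> sorted_wrt (>) (v # map (skip v) (?s 0))"
  proof -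
    have "segment lam \<pi> 0 = (v # map (skip v) (?s 0)) @ rear 0"
      using e(2) ne by (auto simp: seg front_def)
    then show ?thesis
      using s_gt[of _ 0] v2 by (auto simp: sorted_wrt_append rear_def)
  qed
  also have "\<dots> \<longleftrightarrow> sorted_wrt (>) (?s 0) \<and> (?s 0 \<noteq> [] \<longrightarrow> hd (?s 0) \<le> v - 2)"
  proof (cases "?s 0")
    case (Cons y ys)
    have "sorted_wrt (>) (v # map (skip v) (?s 0)) \<longleftrightarrow> skip v y < v \<and> sorted_wrt (>) (?s 0)"
      using Cons strict_mono_less[OF strict_mono_skip, of v]
      by (auto simp: sorted_wrt_map) (meson order.strict_trans)
    then show ?thesis
      using Cons s_pos[of y 0] by (auto simp: skip_less_iff[OF v2])
  qed simp
  finally show ?dec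
    using s0 s0_ne \<open>psum lam' r = v - 2\<close> by auto
qed

text \<open>A leading 1 is followed by an ascent or by nothing. Hence no descent arises, and the
  first segment is decreasing only if 1 is its sole entry.\<close>

lemma insert_fixed_point_unimodal:
  assumes pos: "0 \<notin> set lam" and ne: "lam \<noteq> []" and lam': "lam' = decr 0 lam"
    and \<pi>': "\<pi>' \<in> involutions (sum_list lam')" and \<pi>: "\<pi> = insert_orbit 1 \<pi>'"
  shows "(\<forall>i<length lam. unimodal (segment lam \<pi> i)) \<longleftrightarrow> (\<forall>i<length lam'. unimodal (segment lam' \<pi>' i))"
    and "des lam \<pi> = des lam' \<pi>'"
    and "sorted_wrt (>) (segment lam \<pi> 0) \<longleftrightarrow> lam ! 0 = 1"
    and "1 \<le> sum_list lam" "rank 1 (sum_list lam) = sum_list lam'"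
proof -
  note part_pos = part_pos[OF pos]
  have len: "length lam' = length lam"
    by (simp add: lam')
  have psum': "psum lam' i = rank 1 (psum lam i)" for i
    unfolding lam' using part_pos[of 0] ne by (auto simp: psum_decr rank_def)
  show "1 \<le> sum_list lam"
    by (rule sum_list_pos[OF pos ne])
  from psum'[of "length lam"] show "rank 1 (sum_list lam) = sum_list lam'"
    by (metis len psum_length)
  have s_gt: "1 < x" if "x \<in> set (map (skip 1) (segment lam' \<pi>' i))" for x i
    using that segment_positive[OF \<pi>'] skip_gt_1 by fastforce
  let ?s = "\<lambda>i. segment lam' \<pi>' i"
  have seg: "segment lam \<pi> i = (if i = 0 then [1] else []) @ map (skip 1) (?s i)"
    if i: "i < length lam" for i
  proof -
    let ?ps = "if i = 0 then [1] else []" and ?lo = "if i = 0 then 2 else Suc (psum lam i)"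
    have "[Suc (psum lam i)..<Suc (psum lam (Suc i))] = ?ps @ [?lo..<Suc (psum lam (Suc i))] @ []"
      using part_pos[OF i] i by (auto simp: psum_Suc upt_conv_Cons numeral_2_eq_2 simp del: upt_Suc)
    moreover have "1 \<notin> set [?lo..<Suc (psum lam (Suc i))]"
      using psum_pos[OF pos, of i] i by auto
    ultimately have "segment lam \<pi> i = map \<pi> ?ps @ map (skip 1) (?s i) @ map \<pi> []"
      unfolding \<pi> by (intro segment_insert_orbit[OF _ psum' i]) auto
    then show ?thesis
      by (simp add: \<pi>)
  qed
  have "unimodal (segment lam \<pi> i) \<longleftrightarrow> unimodal (?s i)" if "i < length lam" for i
    using unimodal_Cons_less[of "map (skip 1) (?s i)" 1] s_gt[of _ i]
    by (auto simp: seg[OF that] unimodal_map strict_mono_skip)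
  then show "(\<forall>i<length lam. unimodal (segment lam \<pi> i)) \<longleftrightarrow> (\<forall>i<length lam'. unimodal (?s i))"
    by (simp add: len)
  have "descents (segment lam \<pi> i) = descents (?s i)" if "i < length lam" for i
  proof -
    have "descents (1 # map (skip 1) (?s i)) = descents (?s i)"
      by (subst descents_Cons_less) (use s_gt in \<open>blast, simp add: descents_map strict_mono_skip\<close>)
    then show ?thesis
      by (auto simp: seg[OF that] descents_map strict_mono_skip)
  qed
  then show "des lam \<pi> = des lam' \<pi>'"
    by (simp add: des_eq_sum_descents len)
  have "sorted_wrt (>) (segment lam \<pi> 0) \<longleftrightarrow> ?s 0 = []"
    using seg[of 0] ne s_gt[of _ 0] by (cases "?s 0") auto
  also have "\<dots> \<longleftrightarrow> lam ! 0 = 1"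
  proof -
    have "length (?s 0) = lam ! 0 - 1"
      using length_segment[of 0 lam' \<pi>'] ne len by (simp add: lam' nth_decr)
    then show ?thesis
      using part_pos[of 0] ne by (cases "?s 0") auto
  qed
  finally show "sorted_wrt (>) (segment lam \<pi> 0) \<longleftrightarrow> lam ! 0 = 1" .
qed

section \<open>Recurrences for the descent polynomials\<close>

definition descent_poly :: "nat list \<Rightarrow> (nat \<Rightarrow> nat) set \<Rightarrow> int poly" where
  "descent_poly lam A = (\<Sum>\<pi>\<in>A. monom 1 (des lam \<pi>))"

abbreviation t :: "int poly" where
  "t \<equiv> monom 1 1"

lemma monom_plus_1: "monom 1 (n + 1) = t * monom 1 n"
  by (simp add: mult_monom)

lemma descent_poly_disjoint:
  assumes "C = A \<union> B" "A \<inter> B = {}" "finite C"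
  shows "descent_poly lam C = descent_poly lam A + descent_poly lam B"
  unfolding descent_poly_def using assms by (simp add: sum.union_disjoint)

lemma bij_betw_Collect_conj:
  assumes "bij_betw f A B" "\<And>x. x \<in> A \<Longrightarrow> P x \<longleftrightarrow> Q (f x)"
  shows "bij_betw f {x \<in> A. P x} {y \<in> B. Q y}"
  using assms unfolding bij_betw_def by (auto intro: inj_on_subset)

text \<open>
  Generating polynomials of the involutions that remain after removing $1$ and $\<pi>_1$, where the
  parts up to \<open>r\<close> are those before $\<pi>_1$. If the first part is not exhausted, unimodality requires
  membership in \<open>unimodal_involutions_I r\<close>, and an additional descent at the front is lost
  exactly for the members of \<open>unimodal_involutions_D r\<close>.
\<close>

definition step_poly :: "nat \<Rightarrow> nat list \<Rightarrow> int poly" where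
  "step_poly r lam = (if 0 < lam ! 0
     then descent_poly lam (unimodal_involutions_I r lam) +
       (t - 1) * descent_poly lam (unimodal_involutions_D r lam)
     else descent_poly lam (unimodal_involutions lam))"

text \<open>In a decreasing first segment any entry after \<open>v\<close> is smaller than
  \<open>v\<close>, so every admissible involution gains the descent there: a uniform factor
  \<open>t\<close> instead of the correction by \<open>t - 1\<close>.\<close>

definition step_poly_decreasing :: "nat \<Rightarrow> nat list \<Rightarrow> int poly" where
  "step_poly_decreasing r lam = (if 0 < lam ! 0
     then t * descent_poly lam (unimodal_involutions_D r lam)
     else descent_poly lam (unimodal_involutions lam))"

lemma finite_unimodal_involutions_I_D [simp]:
  "finite (unimodal_involutions_I r lam)" "finite (unimodal_involutions_D r lam)"
  by (simp_all add: unimodal_involutions_I_def unimodal_involutions_D_def)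

text \<open>Along \<open>insert_orbit v\<close> the exponent of t grows once for a 1 at the end of
  segment \<open>j\<close> and once for a descent right after \<open>v\<close>. Only the second
  depends on the involution and so stays inside the step polynomial.\<close>

lemma descent_poly_orbit:
  fixes e :: bool
  assumes pos: "0 \<notin> set lam" and j: "j < length lam"
    and e: "if e then 2 \<le> lam ! j else 0 < j"
    and v: "v = (if e then psum lam (Suc j) else Suc (psum lam j))"
    and lam': "lam' = decr j (decr 0 lam)" and r: "r = (if e then Suc j else j)"
  shows "descent_poly lam {\<pi> \<in> unimodal_involutions lam. \<pi> 1 = v} =
      (if e then t else 1) * step_poly r lam'"
    and "descent_poly lam {\<pi> \<in> unimodal_involutions lam. \<pi> 1 = v \<and> sorted_wrt (>) (segment lam \<pi> 0)} =
      (if e then t else 1) * step_poly_decreasing r lam'"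
proof -
  note ins = insert_orbit_unimodal[OF pos j e v lam' r _ refl]
  \<comment> \<open>The last three facts of \<open>ins\<close> do not mention the smaller
    involution, so any involution, here \<open>id\<close>, yields them.\<close>
  have "id \<in> involutions n" for n
    by (simp add: involutions_def)
  note v2 = ins(4-6)[OF this]
  have bij: "bij_betw (insert_orbit v) (involutions (sum_list lam')) {\<pi> \<in> involutions (sum_list lam). \<pi> 1 = v}"
    using bij_betw_insert_orbit[of v "sum_list lam"] v2 by simp
  define A where "A = (if 0 < lam' ! 0 then unimodal_involutions_I r lam' else unimodal_involutions lam')"
  define B where "B = (if 0 < lam' ! 0 then unimodal_involutions_D r lam' else unimodal_involutions lam')"
  have A: "A = {\<pi> \<in> involutions (sum_list lam'). (\<forall>i<length lam'. unimodal (segment lam' \<pi> i)) \<and>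
      (0 < lam' ! 0 \<longrightarrow> \<pi> 1 \<le> psum lam' r \<and> sorted_wrt (>) (segment lam' \<pi> 0) \<or> \<pi> 1 > psum lam' r)}"
    by (auto simp: A_def unimodal_involutions_I_def unimodal_involutions_eq)
  have lam'_ne: "lam' \<noteq> []"
    using j by (auto simp flip: length_greater_0_conv simp: lam')
  \<comment> \<open>If the first part is exhausted, segment 0 is empty and thus decreasing, which
    agrees with \<open>B = A\<close> in that case.\<close>
  have B: "B = {\<pi> \<in> A. sorted_wrt (>) (segment lam' \<pi> 0) \<and> (0 < lam' ! 0 \<longrightarrow> \<pi> 1 \<le> psum lam' r)}"
    using lam'_ne
    by (auto simp: A_def B_def unimodal_involutions_I_def unimodal_involutions_D_def segment_0)
  have fin: "finite A" "finite B"
    by (auto simp: A_def B_def)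
  have A_inv: "\<pi> \<in> involutions (sum_list lam')" if "\<pi> \<in> A" for \<pi>
    using that by (simp add: A)
  have "{\<pi> \<in> unimodal_involutions lam. \<pi> 1 = v} =
      {\<pi> \<in> {\<pi> \<in> involutions (sum_list lam). \<pi> 1 = v}. \<forall>i<length lam. unimodal (segment lam \<pi> i)}"
    by (auto simp: unimodal_involutions_eq)
  then have bijA: "bij_betw (insert_orbit v) A {\<pi> \<in> unimodal_involutions lam. \<pi> 1 = v}"
    unfolding A using bij_betw_Collect_conj[OF bij] ins(1) by simp
  have "{\<pi> \<in> unimodal_involutions lam. \<pi> 1 = v \<and> sorted_wrt (>) (segment lam \<pi> 0)} =
      {\<pi> \<in> {\<pi> \<in> unimodal_involutions lam. \<pi> 1 = v}. sorted_wrt (>) (segment lam \<pi> 0)}"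
    by auto
  then have bijB: "bij_betw (insert_orbit v) B
      {\<pi> \<in> unimodal_involutions lam. \<pi> 1 = v \<and> sorted_wrt (>) (segment lam \<pi> 0)}"
    unfolding B using bij_betw_Collect_conj[OF bijA] ins(3)[OF A_inv] by simp
  let ?c = "if e then t else 1" and ?w = "\<lambda>\<pi>. if 0 < lam' ! 0 \<and> \<pi> 1 \<le> psum lam' r then t else 1"
  have wt: "monom 1 (des lam (insert_orbit v \<pi>)) = ?c * (?w \<pi> * monom 1 (des lam' \<pi>))" if "\<pi> \<in> A" for \<pi>
    using ins(2)[OF A_inv[OF that]] by (simp add: monom_plus_1 del: One_nat_def)
  have "descent_poly lam {\<pi> \<in> unimodal_involutions lam. \<pi> 1 = v} =
      (\<Sum>\<pi>\<in>A. monom 1 (des lam (insert_orbit v \<pi>)))"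
    unfolding descent_poly_def by (rule sum.reindex_bij_betw[OF bijA, symmetric])
  also have "\<dots> = ?c * (\<Sum>\<pi>\<in>A. ?w \<pi> * monom 1 (des lam' \<pi>))"
    unfolding sum_distrib_left by (intro sum.cong refl wt)
  also have "(\<Sum>\<pi>\<in>A. ?w \<pi> * monom 1 (des lam' \<pi>)) = step_poly r lam'"
  proof (cases "0 < lam' ! 0")
    case True
    \<comment> \<open>The weight \<open>t\<close> on \<open>B\<close> is written as 1 + (t - 1),
      with the first summand merged into the sum over all of \<open>A\<close>.\<close>
    have "(\<Sum>\<pi>\<in>A. ?w \<pi> * monom 1 (des lam' \<pi>)) =
        (\<Sum>\<pi>\<in>A. monom 1 (des lam' \<pi>) + (if \<pi> \<in> B then (t - 1) * monom 1 (des lam' \<pi>) else 0))"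
    proof (intro sum.cong refl)
      fix \<pi>
      assume "\<pi> \<in> A"
      then have "\<pi> \<in> B \<longleftrightarrow> \<pi> 1 \<le> psum lam' r"
        using True by (auto simp: B) (auto simp: A)
      then show "?w \<pi> * monom 1 (des lam' \<pi>) =
          monom 1 (des lam' \<pi>) + (if \<pi> \<in> B then (t - 1) * monom 1 (des lam' \<pi>) else 0)"
        using True by (simp add: algebra_simps)
    qed
    also have "\<dots> = descent_poly lam' A + (t - 1) * descent_poly lam' (A \<inter> B)"
      by (simp only: sum.distrib descent_poly_def sum_distrib_left flip: sum.inter_restrict[OF fin(1)])
    also have "A \<inter> B = B"
      by (auto simp: B)
    finally show ?thesis
      using True by (simp add: step_poly_def A_def B_def)
  next
    case False
    then show ?thesis
      by (simp add: step_poly_def A_def descent_poly_def)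
  qed
  finally show "descent_poly lam {\<pi> \<in> unimodal_involutions lam. \<pi> 1 = v} = ?c * step_poly r lam'" .
  have "descent_poly lam {\<pi> \<in> unimodal_involutions lam. \<pi> 1 = v \<and> sorted_wrt (>) (segment lam \<pi> 0)} =
      (\<Sum>\<pi>\<in>B. monom 1 (des lam (insert_orbit v \<pi>)))"
    unfolding descent_poly_def by (rule sum.reindex_bij_betw[OF bijB, symmetric])
  also have "\<dots> = (\<Sum>\<pi>\<in>B. ?c * ((if 0 < lam' ! 0 then t else 1) * monom 1 (des lam' \<pi>)))"
    using wt by (intro sum.cong refl) (auto simp: B)
  also have "\<dots> = ?c * ((if 0 < lam' ! 0 then t else 1) * descent_poly lam' B)"
    by (simp only: descent_poly_def sum_distrib_left)
  also have "(if 0 < lam' ! 0 then t else 1) * descent_poly lam' B = step_poly_decreasing r lam'"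
    by (simp add: step_poly_decreasing_def B_def)
  finally show "descent_poly lam {\<pi> \<in> unimodal_involutions lam. \<pi> 1 = v \<and> sorted_wrt (>) (segment lam \<pi> 0)} =
      ?c * step_poly_decreasing r lam'" .
qed

lemma descent_poly_fixed_point:
  assumes pos: "0 \<notin> set lam" and ne: "lam \<noteq> []" and lam': "lam' = decr 0 lam"
  shows "descent_poly lam {\<pi> \<in> unimodal_involutions lam. \<pi> 1 = 1} =
      descent_poly lam' (unimodal_involutions lam')"
    and "descent_poly lam {\<pi> \<in> unimodal_involutions lam. \<pi> 1 = 1 \<and> sorted_wrt (>) (segment lam \<pi> 0)} =
      (if lam ! 0 = 1 then descent_poly lam' (unimodal_involutions lam') else 0)"
proof -
  note ins = insert_fixed_point_unimodal[OF pos ne lam' _ refl]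
  have "id \<in> involutions n" for n
    by (simp add: involutions_def)
  note n = ins(4,5)[OF this]
  have bij: "bij_betw (insert_orbit 1) (involutions (sum_list lam')) {\<pi> \<in> involutions (sum_list lam). \<pi> 1 = 1}"
    using bij_betw_insert_orbit[of 1 "sum_list lam"] n by simp
  have "{\<pi> \<in> unimodal_involutions lam. \<pi> 1 = 1} =
      {\<pi> \<in> {\<pi> \<in> involutions (sum_list lam). \<pi> 1 = 1}. \<forall>i<length lam. unimodal (segment lam \<pi> i)}"
    by (auto simp: unimodal_involutions_eq)
  then have bij': "bij_betw (insert_orbit 1) (unimodal_involutions lam') {\<pi> \<in> unimodal_involutions lam. \<pi> 1 = 1}"
    unfolding unimodal_involutions_eq[of lam'] using bij_betw_Collect_conj[OF bij] ins(1) by simp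
  show eq: "descent_poly lam {\<pi> \<in> unimodal_involutions lam. \<pi> 1 = 1} =
      descent_poly lam' (unimodal_involutions lam')"
    unfolding descent_poly_def sum.reindex_bij_betw[OF bij', symmetric]
    using ins(2) by (intro sum.cong refl) (simp add: unimodal_involutions_eq)
  have "sorted_wrt (>) (segment lam \<pi> 0) \<longleftrightarrow> lam ! 0 = 1"
    if \<pi>: "\<pi> \<in> unimodal_involutions lam" "\<pi> 1 = 1" for \<pi>
  proof -
    obtain \<pi>' where "\<pi>' \<in> unimodal_involutions lam'" "\<pi> = insert_orbit 1 \<pi>'"
      using \<pi> bij' unfolding bij_betw_def by blast
    then show ?thesis
      using ins(3)[of \<pi>'] by (simp add: unimodal_involutions_eq)
  qed
  then have "{\<pi> \<in> unimodal_involutions lam. \<pi> 1 = 1 \<and> sorted_wrt (>) (segment lam \<pi> 0)} =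
      (if lam ! 0 = 1 then {\<pi> \<in> unimodal_involutions lam. \<pi> 1 = 1} else {})"
    by auto
  then show "descent_poly lam {\<pi> \<in> unimodal_involutions lam. \<pi> 1 = 1 \<and> sorted_wrt (>) (segment lam \<pi> 0)} =
      (if lam ! 0 = 1 then descent_poly lam' (unimodal_involutions lam') else 0)"
    using eq by (simp add: descent_poly_def)
qed

section \<open>Classification by the segment containing the first value\<close>

text \<open>This class is counted by E_{j+1}; \<open>j\<close> starts at 0 like the numbering of
  segments.\<close>

definition starting_in :: "nat \<Rightarrow> nat list \<Rightarrow> (nat \<Rightarrow> nat) set" where
  "starting_in j lam = {\<pi> \<in> unimodal_involutions lam. psum lam j < \<pi> 1 \<and> \<pi> 1 \<le> psum lam (Suc j)}"

definition starting_in_decreasing :: "nat \<Rightarrow> nat list \<Rightarrow> (nat \<Rightarrow> nat) set" where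
  "starting_in_decreasing j lam = {\<pi> \<in> starting_in j lam. sorted_wrt (>) (segment lam \<pi> 0)}"

lemma descent_poly_starting_in:
  assumes pos: "0 \<notin> set lam" and j: "0 < j" "j < length lam" and lam': "lam' = decr j (decr 0 lam)"
  shows "descent_poly lam (starting_in j lam) =
      step_poly j lam' + (if 2 \<le> lam ! j then t * step_poly (Suc j) lam' else 0)"
    and "descent_poly lam (starting_in_decreasing j lam) =
      step_poly_decreasing j lam' + (if 2 \<le> lam ! j then t * step_poly_decreasing (Suc j) lam' else 0)"
proof -
  have "0 < lam ! j"
    using part_pos[OF pos] j by simp
  let ?u = "Suc (psum lam j)" and ?v = "psum lam (Suc j)"
  let ?S = "\<lambda>P v. {\<pi> \<in> unimodal_involutions lam. \<pi> 1 = v \<and> P \<pi>}"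
  have v: "?v = psum lam j + lam ! j"
    using j by (simp add: psum_Suc)
  \<comment> \<open>The predicate \<open>P\<close> is instantiated by truth and by decrease of the
    first segment, so both claims share one split. For a part of size 1 the two ends coincide and
    must not be counted twice.\<close>
  have split: "descent_poly lam {\<pi> \<in> starting_in j lam. P \<pi>} =
      descent_poly lam (?S P ?u) + (if 2 \<le> lam ! j then descent_poly lam (?S P ?v) else 0)" for P
  proof -
    have eq: "{\<pi> \<in> starting_in j lam. P \<pi>} = ?S P ?u \<union> ?S P ?v"
      using orbit_of_1_at_segment_end[of _ lam j] j v \<open>0 < lam ! j\<close> by (auto simp: starting_in_def)
    show ?thesis
    proof (cases "2 \<le> lam ! j")
      case True
      then have "?S P ?u \<inter> ?S P ?v = {}"
        using v by auto
      then show ?thesis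
        using descent_poly_disjoint[OF eq, of lam] True by (simp add: starting_in_def)
    next
      case False
      then have "?u = ?v"
        using v \<open>0 < lam ! j\<close> by simp
      then show ?thesis
        using False eq by simp
    qed
  qed
  have first: "descent_poly lam {\<pi> \<in> unimodal_involutions lam. \<pi> 1 = ?u} = step_poly j lam'"
      "descent_poly lam (?S (\<lambda>\<pi>. sorted_wrt (>) (segment lam \<pi> 0)) ?u) = step_poly_decreasing j lam'"
    using descent_poly_orbit[OF pos j(2) _ _ lam', where e = False and v = ?u and r = j] j(1) by simp_all
  have last: "descent_poly lam {\<pi> \<in> unimodal_involutions lam. \<pi> 1 = ?v} = t * step_poly (Suc j) lam'"
      "descent_poly lam (?S (\<lambda>\<pi>. sorted_wrt (>) (segment lam \<pi> 0)) ?v) = t * step_poly_decreasing (Suc j) lam'"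
    if "2 \<le> lam ! j"
    using descent_poly_orbit[OF pos j(2) _ _ lam', where e = True and v = ?v and r = "Suc j"] that by simp_all
  show "descent_poly lam (starting_in j lam) =
      step_poly j lam' + (if 2 \<le> lam ! j then t * step_poly (Suc j) lam' else 0)"
    using split[of "\<lambda>_. True"] unfolding simp_thms Collect_mem_eq by (simp only: first last cong: if_cong)
  show "descent_poly lam (starting_in_decreasing j lam) =
      step_poly_decreasing j lam' + (if 2 \<le> lam ! j then t * step_poly_decreasing (Suc j) lam' else 0)"
    unfolding starting_in_decreasing_def split by (simp only: first last cong: if_cong)
qed

text \<open>Here the first position of the segment is 1 itself, so this end gives a fixed point and
  removes one position only; the other end removes two positions from the same part.\<close>

lemma descent_poly_starting_in_0:
  assumes pos: "0 \<notin> set lam" and ne: "lam \<noteq> []" and lam': "lam' = decr 0 lam"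
  shows "descent_poly lam (starting_in 0 lam) =
      descent_poly lam' (unimodal_involutions lam') +
      (if 2 \<le> lam ! 0 then t * step_poly 1 (decr 0 lam') else 0)"
    and "descent_poly lam (starting_in_decreasing 0 lam) =
      (if lam ! 0 = 1 then descent_poly lam' (unimodal_involutions lam') else 0) +
      (if 2 \<le> lam ! 0 then t * step_poly_decreasing 1 (decr 0 lam') else 0)"
proof -
  have 0: "0 < length lam" "0 < lam ! 0"
    using part_pos[OF pos, of 0] ne by auto
  let ?v = "psum lam (Suc 0)"
  let ?S = "\<lambda>P v. {\<pi> \<in> unimodal_involutions lam. \<pi> 1 = v \<and> P \<pi>}"
  have v: "?v = lam ! 0"
    using ne by (simp add: psum_Suc)
  have split: "descent_poly lam {\<pi> \<in> starting_in 0 lam. P \<pi>} =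
      descent_poly lam (?S P 1) + (if 2 \<le> lam ! 0 then descent_poly lam (?S P ?v) else 0)" for P
  proof -
    have eq: "{\<pi> \<in> starting_in 0 lam. P \<pi>} = ?S P 1 \<union> ?S P ?v"
      using orbit_of_1_at_segment_end[of _ lam 0] 0 v by (auto simp: starting_in_def)
    show ?thesis
    proof (cases "2 \<le> lam ! 0")
      case True
      then have "?S P 1 \<inter> ?S P ?v = {}"
        using v by auto
      then show ?thesis
        using descent_poly_disjoint[OF eq, of lam] True by (simp add: starting_in_def)
    next
      case False
      then have "?v = 1"
        using v 0 by simp
      then show ?thesis
        using False eq by simp
    qed
  qed
  have last: "descent_poly lam {\<pi> \<in> unimodal_involutions lam. \<pi> 1 = ?v} = t * step_poly 1 (decr 0 lam')"
      "descent_poly lam (?S (\<lambda>\<pi>. sorted_wrt (>) (segment lam \<pi> 0)) ?v) = t * step_poly_decreasing 1 (decr 0 lam')"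
    if "2 \<le> lam ! 0"
    using descent_poly_orbit[OF pos 0(1) _ _ refl, where e = True and v = ?v and r = 1] that lam' by simp_all
  show "descent_poly lam (starting_in 0 lam) = descent_poly lam' (unimodal_involutions lam') +
      (if 2 \<le> lam ! 0 then t * step_poly 1 (decr 0 lam') else 0)"
    using split[of "\<lambda>_. True"] unfolding simp_thms Collect_mem_eq descent_poly_fixed_point(1)[OF pos ne lam']
    by (simp only: last cong: if_cong)
  show "descent_poly lam (starting_in_decreasing 0 lam) =
      (if lam ! 0 = 1 then descent_poly lam' (unimodal_involutions lam') else 0) +
      (if 2 \<le> lam ! 0 then t * step_poly_decreasing 1 (decr 0 lam') else 0)"
    unfolding starting_in_decreasing_def split descent_poly_fixed_point(2)[OF pos ne lam']
    by (simp only: last cong: if_cong)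
qed

lemma descent_poly_eq_sum_starting_in:
  assumes "0 \<notin> set lam" "lam \<noteq> []"
  shows "descent_poly lam (unimodal_involutions lam) = (\<Sum>i<length lam. descent_poly lam (starting_in i lam))"
    and "j \<le> length lam \<Longrightarrow> descent_poly lam (unimodal_involutions_I j lam) =
      descent_poly lam (unimodal_involutions_D j lam) +
      (\<Sum>i\<in>{j..<length lam}. descent_poly lam (starting_in i lam))"
proof -
  have first: "0 < \<pi> 1" "\<pi> 1 \<le> sum_list lam" if "\<pi> \<in> unimodal_involutions lam" for \<pi>
  proof -
    have "1 \<in> {1..sum_list lam}"
      using sum_list_pos[OF assms] by simp
    moreover have "\<pi> \<in> involutions (sum_list lam)"
      using that by (simp add: unimodal_involutions_eq)
    ultimately have "\<pi> 1 \<in> {1..sum_list lam}"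
      by (rule involutions_in_range[rotated])
    then show "0 < \<pi> 1" "\<pi> 1 \<le> sum_list lam"
      by simp_all
  qed
  have later: "descent_poly lam {\<pi> \<in> unimodal_involutions lam. \<pi> 1 > psum lam j} =
      (\<Sum>i\<in>{j..<length lam}. descent_poly lam (starting_in i lam))" if "j \<le> length lam" for j
  proof -
    have "{\<pi> \<in> unimodal_involutions lam. \<pi> 1 > psum lam j} = (\<Union>i\<in>{j..<length lam}. starting_in i lam)"
    proof (intro equalityI subsetI)
      fix \<pi>
      assume \<pi>: "\<pi> \<in> {\<pi> \<in> unimodal_involutions lam. \<pi> 1 > psum lam j}"
      then obtain p where p: "p < length lam" "psum lam p < \<pi> 1" "\<pi> 1 \<le> psum lam (Suc p)"
        using psum_interval[of "\<pi> 1" lam "length lam"] first[of \<pi>] by auto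
      moreover have "j \<le> p"
        using p \<pi> psum_mono[of "Suc p" j lam] by (cases "j \<le> p") auto
      ultimately show "\<pi> \<in> (\<Union>i\<in>{j..<length lam}. starting_in i lam)"
        using \<pi> by (auto simp: starting_in_def)
    next
      fix \<pi>
      assume "\<pi> \<in> (\<Union>i\<in>{j..<length lam}. starting_in i lam)"
      then show "\<pi> \<in> {\<pi> \<in> unimodal_involutions lam. \<pi> 1 > psum lam j}"
        using psum_mono[of j _ lam] by (fastforce simp: starting_in_def)
    qed
    moreover have "starting_in i lam \<inter> starting_in i' lam = {}" if "i \<noteq> i'" for i i'
      using that psum_interval_unique[of lam i _ i'] by (auto simp: starting_in_def)
    moreover have "finite (starting_in i lam)" for i
      by (simp add: starting_in_def)
    ultimately show ?thesis
      unfolding descent_poly_def by (simp add: sum.UNION_disjoint)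
  qed
  have "unimodal_involutions lam = {\<pi> \<in> unimodal_involutions lam. \<pi> 1 > psum lam 0}"
    using first by auto
  then show "descent_poly lam (unimodal_involutions lam) = (\<Sum>i<length lam. descent_poly lam (starting_in i lam))"
    using later[of 0] by (simp add: atLeast0LessThan)
  assume j: "j \<le> length lam"
  have "unimodal_involutions_I j lam =
      unimodal_involutions_D j lam \<union> {\<pi> \<in> unimodal_involutions lam. \<pi> 1 > psum lam j}"
    by (auto simp: unimodal_involutions_I_def unimodal_involutions_D_def)
  then have "descent_poly lam (unimodal_involutions_I j lam) = descent_poly lam (unimodal_involutions_D j lam) +
      descent_poly lam {\<pi> \<in> unimodal_involutions lam. \<pi> 1 > psum lam j}"
    by (rule descent_poly_disjoint) (auto simp: unimodal_involutions_D_def)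
  then show "descent_poly lam (unimodal_involutions_I j lam) =
      descent_poly lam (unimodal_involutions_D j lam) +
      (\<Sum>i\<in>{j..<length lam}. descent_poly lam (starting_in i lam))"
    using later[OF j] by simp
qed

lemma descent_poly_D_Suc:
  "descent_poly lam (unimodal_involutions_D (Suc j) lam) =
    descent_poly lam (unimodal_involutions_D j lam) + descent_poly lam (starting_in_decreasing j lam)"
proof (rule descent_poly_disjoint)
  show "unimodal_involutions_D (Suc j) lam = unimodal_involutions_D j lam \<union> starting_in_decreasing j lam"
    using psum_mono[of j "Suc j" lam]
    by (auto simp: unimodal_involutions_D_def starting_in_decreasing_def starting_in_def)
qed (auto simp: unimodal_involutions_D_def starting_in_decreasing_def starting_in_def)

lemma unimodal_involutions_D_0:
  assumes "0 \<notin> set lam" "lam \<noteq> []"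
  shows "unimodal_involutions_D 0 lam = {}"
proof -
  have "1 \<in> {1..sum_list lam}"
    using sum_list_pos[OF assms] by simp
  then have "1 \<le> \<pi> 1" if "\<pi> \<in> unimodal_involutions lam" for \<pi>
    using involutions_in_range[of \<pi> "sum_list lam" 1] that by (simp add: unimodal_involutions_eq)
  then show ?thesis
    by (fastforce simp: unimodal_involutions_D_def)
qed

section \<open>Series as functions of weak compositions\<close>

text \<open>
  \<open>series k c\<close> is the sum of $c(\lambda) x^\lambda$ over all weak compositions $\lambda$ with
  \<open>k\<close> parts. Deleting the variables in \<open>Z\<close> corresponds to putting zeros at the positions in \<open>Z\<close>.
\<close>

definition series :: "nat \<Rightarrow> (nat list \<Rightarrow> int poly) \<Rightarrow> int poly mfps" where
  "series k c = Abs_mfps (\<lambda>\<mu>. if Poly_Mapping.keys \<mu> \<subseteq> {1..k}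
     then c (map (Poly_Mapping.lookup \<mu>) [1..<Suc k]) else 0)"

lemma series_cong: "(\<And>l. length l = k \<Longrightarrow> c l = d l) \<Longrightarrow> series k c = series k d"
  by (simp add: series_def del: upt_Suc cong: if_cong)

lemma series_add: "series k c + series k d = series k (\<lambda>l. c l + d l)"
  by (rule mfps_eqI) (simp add: series_def)

lemma series_0: "series k (\<lambda>_. 0) = 0"
  by (rule mfps_eqI) (simp add: series_def)

lemma series_sum: "finite S \<Longrightarrow> (\<Sum>i\<in>S. series k (c i)) = series k (\<lambda>l. \<Sum>i\<in>S. c i l)"
  by (induction S rule: finite_induct) (simp_all add: series_add series_0)

lemma mcoeff_T_mult: "mcoeff (T * F) \<mu> = t * mcoeff F \<mu>"
proof -
  have "mcoeff (T * F) \<mu> = (\<Sum>p\<in>{(0, \<mu>)}. mcoeff T (fst p) * mcoeff F (snd p))"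
    unfolding mcoeff_mult case_prod_beta
    by (intro sum.mono_neutral_right finite_splits) (auto simp: splits_def T_def)
  then show ?thesis
    by (simp add: T_def)
qed

lemma series_T: "T * series k c = series k (\<lambda>l. t * c l)"
  by (rule mfps_eqI) (simp add: series_def mcoeff_T_mult)

lemma series_T_plus: "(T + 1) * series k c = series k (\<lambda>l. (t + 1) * c l)"
  by (simp add: distrib_right series_T series_add)

lemma series_T_minus: "(T - 1) * series k c = series k (\<lambda>l. (t - 1) * c l)"
  by (rule mfps_eqI) (simp add: series_def mcoeff_T_mult left_diff_distrib)

lemma mcoeff_X_mult:
  "mcoeff (X i * F) \<mu> =
    (if 0 < Poly_Mapping.lookup \<mu> i then mcoeff F (\<mu> - Poly_Mapping.single i 1) else 0)"
proof (cases "0 < Poly_Mapping.lookup \<mu> i")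
  case True
  let ?s = "Poly_Mapping.single i (1 :: nat)"
  have "?s + (\<mu> - ?s) = \<mu>"
    using True by (intro poly_mapping_eqI) (auto simp: lookup_add lookup_minus lookup_single when_def)
  then have mem: "(?s, \<mu> - ?s) \<in> splits \<mu>"
    by (simp add: splits_def)
  have "mcoeff (X i) (fst p) * mcoeff F (snd p) = 0" if "p \<in> splits \<mu> - {(?s, \<mu> - ?s)}" for p
  proof -
    have sum: "fst p + snd p = \<mu>"
      using that by (auto simp: splits_def)
    have "snd p = \<mu> - fst p"
      unfolding sum[symmetric] by simp
    then have "fst p \<noteq> ?s"
      using that by (metis DiffD2 insertI1 prod.collapse)
    then show ?thesis
      by (simp add: X_def)
  qed
  then have "mcoeff (X i * F) \<mu> = (\<Sum>p\<in>{(?s, \<mu> - ?s)}. mcoeff (X i) (fst p) * mcoeff F (snd p))"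
    unfolding mcoeff_mult case_prod_beta using mem
    by (intro sum.mono_neutral_right finite_splits) blast+
  then show ?thesis
    using True by (simp add: X_def)
next
  case False
  have "mcoeff (X i) \<alpha> * mcoeff F \<beta> = 0" if "\<alpha> + \<beta> = \<mu>" for \<alpha> \<beta>
  proof -
    have "\<alpha> \<noteq> Poly_Mapping.single i 1"
      using False that[symmetric] by (auto simp: lookup_add)
    then show ?thesis
      by (simp add: X_def)
  qed
  then show ?thesis
    unfolding mcoeff_mult splits_def using False by (auto intro: sum.neutral)
qed

text \<open>The variable factors of the recurrences thereby become removals of positions: part
  \<open>p\<close>, counted from 0, belongs to the variable \<open>X (Suc p)\<close>.\<close>

lemma series_X:
  assumes "p < k"
  shows "X (Suc p) * series k c = series k (\<lambda>l. if 0 < l ! p then c (decr p l) else 0)"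
proof (rule mfps_eqI)
  fix \<mu> :: "nat \<Rightarrow>\<^sub>0 nat"
  let ?l = "map (Poly_Mapping.lookup \<mu>) [1..<Suc k]"
  let ?\<nu> = "\<mu> - Poly_Mapping.single (Suc p) 1"
  have nth: "?l ! p = Poly_Mapping.lookup \<mu> (Suc p)"
    using assms by (simp del: upt_Suc)
  show "mcoeff (X (Suc p) * series k c) \<mu> = mcoeff (series k (\<lambda>l. if 0 < l ! p then c (decr p l) else 0)) \<mu>"
  proof (cases "0 < Poly_Mapping.lookup \<mu> (Suc p)")
    case True
    have "Poly_Mapping.keys ?\<nu> \<subseteq> {1..k} \<longleftrightarrow> Poly_Mapping.keys \<mu> \<subseteq> {1..k}"
    proof -
      have eq: "Poly_Mapping.keys \<mu> = insert (Suc p) (Poly_Mapping.keys ?\<nu>)"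
        using True by (auto simp: in_keys_iff lookup_minus lookup_single when_def split: if_splits)
      show ?thesis
        unfolding eq using assms by auto
    qed
    moreover have "map (Poly_Mapping.lookup ?\<nu>) [1..<Suc k] = decr p ?l"
      by (rule nth_equalityI) (auto simp: nth_decr lookup_minus lookup_single when_def simp del: upt_Suc)
    ultimately show ?thesis
      using True nth by (simp add: mcoeff_X_mult series_def del: upt_Suc)
  next
    case False
    then show ?thesis
      using nth by (simp add: mcoeff_X_mult series_def del: upt_Suc)
  qed
qed

lemma lookup_exponents:
  "Poly_Mapping.lookup (exponents lam) i = (if 1 \<le> i \<and> i \<le> length lam then lam ! (i - 1) else 0)"
proof -
  have "Poly_Mapping.lookup (exponents lam) i = (\<Sum>p<length lam. if Suc p = i then lam ! p else 0)"
    by (simp add: exponents_def lookup_sum lookup_single when_def)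
  also have "\<dots> = (if 1 \<le> i \<and> i \<le> length lam then lam ! (i - 1) else 0)"
  proof (cases i)
    case (Suc q)
    then show ?thesis
      by (simp add: Suc_le_eq)
  qed simp
  finally show ?thesis .
qed

lemma exponents_eq_iff:
  assumes "length lam = k"
  shows "exponents lam = \<mu> \<longleftrightarrow>
    Poly_Mapping.keys \<mu> \<subseteq> {1..k} \<and> lam = map (Poly_Mapping.lookup \<mu>) [1..<Suc k]"
proof
  assume \<mu>: "exponents lam = \<mu>"
  have "Poly_Mapping.keys \<mu> \<subseteq> {1..k}"
    by (auto simp: \<mu>[symmetric] in_keys_iff lookup_exponents assms split: if_splits)
  moreover have "lam = map (Poly_Mapping.lookup \<mu>) [1..<Suc k]"
    by (rule nth_equalityI) (auto simp: \<mu>[symmetric] lookup_exponents assms simp del: upt_Suc)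
  ultimately show "Poly_Mapping.keys \<mu> \<subseteq> {1..k} \<and> lam = map (Poly_Mapping.lookup \<mu>) [1..<Suc k]"
    by blast
next
  assume \<mu>: "Poly_Mapping.keys \<mu> \<subseteq> {1..k} \<and> lam = map (Poly_Mapping.lookup \<mu>) [1..<Suc k]"
  show "exponents lam = \<mu>"
  proof (rule poly_mapping_eqI)
    fix i
    have "lam ! (i - 1) = Poly_Mapping.lookup \<mu> i" if "1 \<le> i" "i \<le> k"
      using \<mu> that by (simp del: upt_Suc)
    moreover have "Poly_Mapping.lookup \<mu> i = 0" if "\<not> (1 \<le> i \<and> i \<le> k)"
      using \<mu> that by (force simp: in_keys_iff)
    ultimately show "Poly_Mapping.lookup (exponents lam) i = Poly_Mapping.lookup \<mu> i"
      using assms by (auto simp: lookup_exponents)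
  qed
qed

lemma gen_series_eq: "gen_series k A = series k (\<lambda>l. if 0 \<notin> set l then descent_poly l (A l) else 0)"
proof (rule mfps_eqI)
  fix \<mu> :: "nat \<Rightarrow>\<^sub>0 nat"
  define l where "l = map (Poly_Mapping.lookup \<mu>) [1..<Suc k]"
  then have len: "length l = k"
    by simp
  have "lam \<in> compositions k \<and> exponents lam = \<mu> \<longleftrightarrow>
      Poly_Mapping.keys \<mu> \<subseteq> {1..k} \<and> 0 \<notin> set l \<and> lam = l" for lam
  proof -
    have "lam \<in> compositions k \<longleftrightarrow> length lam = k \<and> 0 \<notin> set lam"
      by (auto simp: compositions_def intro: gr0I)
    then show ?thesis
      using exponents_eq_iff[of lam k \<mu>] len unfolding l_def[symmetric] by blast
  qed
  then have "{lam. lam \<in> compositions k \<and> exponents lam = \<mu>} =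
      (if Poly_Mapping.keys \<mu> \<subseteq> {1..k} \<and> 0 \<notin> set l then {l} else {})"
    by auto
  then show "mcoeff (gen_series k A) \<mu> =
      mcoeff (series k (\<lambda>l. if 0 \<notin> set l then descent_poly l (A l) else 0)) \<mu>"
    unfolding gen_series_def series_def descent_poly_def mcoeff_Abs l_def[symmetric] by simp
qed

section \<open>Deleting variables and zero parts\<close>

text \<open>Both lists are increasing, so it suffices that their sets agree. Since \<open>Z\<close>
  lies in \<open>{1..k}\<close>, the enumeration starts with 0 and has used up all of
  \<open>{0..k} - Z\<close> after index \<open>k - card Z\<close>.\<close>

lemma map_enumerate_complement:
  assumes "finite Z" "Z \<subseteq> {1..k}"
  shows "map (enumerate (- Z)) [1..<Suc (k - card Z)] = filter (\<lambda>i. i \<notin> Z) [1..<Suc k]"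
proof -
  let ?e = "enumerate (- Z)" and ?m = "k - card Z"
  have inf: "infinite (- Z)"
    using assms(1) by simp
  have mono: "strict_mono ?e"
    using inf by (rule strict_mono_enumerate)
  have range: "range ?e = - Z"
    using inf by (rule range_enumerate)
  have "?e 0 = 0"
    using assms(2) by (auto simp: enumerate_0 intro: Least_eq_0)
  have "finite ({0..k} - Z)" and sub: "{0..k} - Z \<subseteq> range ?e"
    by (auto simp: range)
  \<comment> \<open>By monotonicity the left side is closed downwards, and it has
    \<open>Suc ?m\<close> elements; a set of this kind is an initial segment.\<close>
  have "{n. ?e n \<le> k} = {..?m}"
  proof -
    have "?e ` {n. ?e n \<le> k} = {0..k} - Z"
    proof (intro equalityI subsetI)
      fix x
      assume x: "x \<in> {0..k} - Z"
      then obtain n where "x = ?e n"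
        using sub by blast
      then show "x \<in> ?e ` {n. ?e n \<le> k}"
        using x by auto
    next
      fix x
      assume "x \<in> ?e ` {n. ?e n \<le> k}"
      then show "x \<in> {0..k} - Z"
        using range by auto
    qed
    then have "card {n. ?e n \<le> k} = card ({0..k} - Z)"
      using strict_mono_imp_inj_on[OF mono] by (metis card_image inj_on_subset subset_UNIV)
    also have "\<dots> = Suc k - card Z"
      using assms by (subst card_Diff_subset) auto
    also have "\<dots> = Suc ?m"
      using card_mono[of "{1..k}" Z] assms by simp
    finally have card: "card {n. ?e n \<le> k} = Suc ?m" .
    have down: "a \<in> {n. ?e n \<le> k}" if "b \<in> {n. ?e n \<le> k}" "a \<le> b" for a b
      using that strict_mono_less_eq[OF mono, of a b] by auto
    have fin: "finite {n. ?e n \<le> k}"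
      using card by (intro card_ge_0_finite) simp
    have "n \<le> ?m" if "n \<in> {n. ?e n \<le> k}" for n
    proof -
      have "{..n} \<subseteq> {n. ?e n \<le> k}"
        using down[OF that] by blast
      then have "card {..n} \<le> Suc ?m"
        using card_mono[OF fin] card by metis
      then show ?thesis
        by simp
    qed
    then have "{n. ?e n \<le> k} \<subseteq> {..?m}"
      by blast
    then show ?thesis
      using card by (intro card_subset_eq) auto
  qed
  then have le_iff: "?e n \<le> k \<longleftrightarrow> n \<le> ?m" for n
    by blast
  have pos_iff: "0 < ?e n \<longleftrightarrow> 0 < n" for n
    using strict_mono_less[OF mono, of 0 n] \<open>?e 0 = 0\<close> by simp
  show ?thesis
  proof (rule sorted_distinct_set_unique)
    show "sorted (map ?e [1..<Suc ?m])"
      unfolding sorted_map by (rule sorted_wrt_mono_rel[OF _ sorted_upt]) (simp only: strict_mono_less_eq[OF mono])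
    show "distinct (map ?e [1..<Suc ?m])"
      using strict_mono_imp_inj_on[OF mono] by (simp add: distinct_map inj_on_subset del: upt_Suc)
    show "set (map ?e [1..<Suc ?m]) = set (filter (\<lambda>i. i \<notin> Z) [1..<Suc k])"
    proof -
      have "?e ` {1..?m} = {1..k} - Z"
      proof (intro equalityI subsetI)
        fix x
        assume "x \<in> {1..k} - Z"
        then obtain n where "x = ?e n"
          using range by (metis ComplI DiffD2 rangeE)
        then show "x \<in> ?e ` {1..?m}"
          using \<open>x \<in> {1..k} - Z\<close> le_iff[of n] pos_iff[of n] by auto
      next
        fix x
        assume "x \<in> ?e ` {1..?m}"
        then obtain n where n: "x = ?e n" "1 \<le> n" "n \<le> ?m"
          by auto
        moreover have "?e n \<notin> Z"
          using range by blast
        ultimately show "x \<in> {1..k} - Z"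
          using le_iff[of n] pos_iff[of n] by auto
      qed
      then show ?thesis
        by (auto simp: atLeastLessThanSuc_atLeastAtMost simp del: upt_Suc)
    qed
  qed (simp_all add: sorted_wrt_filter del: upt_Suc)
qed

text \<open>A monomial in the retained variables is one whose exponents vanish on \<open>Z\<close>;
  its exponents off \<open>Z\<close>, read in increasing order, form the weak composition at which
  \<open>c\<close> is evaluated.\<close>

lemma omit_series:
  assumes "finite Z" "Z \<subseteq> {1..k}"
  shows "omit Z (series (k - card Z) c) = series k (\<lambda>l. if \<forall>i\<in>Z. l ! (i - 1) = 0
    then c (map (\<lambda>i. l ! (i - 1)) (filter (\<lambda>i. i \<notin> Z) [1..<Suc k])) else 0)"
proof (rule mfps_eqI)
  fix \<mu> :: "nat \<Rightarrow>\<^sub>0 nat"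
  let ?e = "enumerate (- Z)" and ?m = "k - card Z"
  let ?\<nu> = "Poly_Mapping.map_key ?e \<mu>"
  let ?l = "map (Poly_Mapping.lookup \<mu>) [1..<Suc k]"
  have inf: "infinite (- Z)"
    using assms(1) by simp
  have mono: "strict_mono ?e"
    using inf by (rule strict_mono_enumerate)
  have inj: "inj ?e"
    using mono by (rule strict_mono_imp_inj_on)
  have e_set: "?e ` {1..?m} = {1..k} - Z"
    using arg_cong[OF map_enumerate_complement[OF assms], of set]
    by (auto simp: atLeastLessThanSuc_atLeastAtMost simp del: upt_Suc)
  have nth: "?l ! (i - 1) = Poly_Mapping.lookup \<mu> i" if "i \<in> {1..k}" for i
  proof -
    have "i - 1 < k" "Suc (i - 1) = i"
      using that by auto
    then show ?thesis
      by (simp del: upt_Suc)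
  qed
  have disj: "Poly_Mapping.keys \<mu> \<inter> Z = {} \<longleftrightarrow> (\<forall>i\<in>Z. ?l ! (i - 1) = 0)"
  proof -
    have "(\<forall>i\<in>Z. ?l ! (i - 1) = 0) \<longleftrightarrow> (\<forall>i\<in>Z. Poly_Mapping.lookup \<mu> i = 0)"
      using nth assms(2) by (metis subsetD)
    then show ?thesis
      by (auto simp: in_keys_iff)
  qed
  show "mcoeff (omit Z (series ?m c)) \<mu> = mcoeff (series k (\<lambda>l. if \<forall>i\<in>Z. l ! (i - 1) = 0
      then c (map (\<lambda>i. l ! (i - 1)) (filter (\<lambda>i. i \<notin> Z) [1..<Suc k])) else 0)) \<mu>"
  proof (cases "Poly_Mapping.keys \<mu> \<inter> Z = {}")
    case True
    have keys: "Poly_Mapping.keys ?\<nu> = ?e -` Poly_Mapping.keys \<mu>"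
      by (auto simp: in_keys_iff map_key.rep_eq inj)
    have "Poly_Mapping.keys ?\<nu> \<subseteq> {1..?m} \<longleftrightarrow> Poly_Mapping.keys \<mu> \<subseteq> {1..k}"
    proof
      assume sub: "Poly_Mapping.keys ?\<nu> \<subseteq> {1..?m}"
      show "Poly_Mapping.keys \<mu> \<subseteq> {1..k}"
      proof
        fix x
        assume x: "x \<in> Poly_Mapping.keys \<mu>"
        then have "x \<in> range ?e"
          using True range_enumerate[OF inf] by auto
        then have "x \<in> ?e ` {1..?m}"
          using x sub keys by auto
        then show "x \<in> {1..k}"
          using e_set by auto
      qed
    next
      assume sub: "Poly_Mapping.keys \<mu> \<subseteq> {1..k}"
      show "Poly_Mapping.keys ?\<nu> \<subseteq> {1..?m}"
      proof
        fix n
        assume "n \<in> Poly_Mapping.keys ?\<nu>"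
        then have "?e n \<in> {1..k} - Z"
          using sub keys True by auto
        then have "?e n \<in> ?e ` {1..?m}"
          using e_set by simp
        then show "n \<in> {1..?m}"
          using inj by (simp add: inj_image_mem_iff)
      qed
    qed
    moreover have "map (Poly_Mapping.lookup ?\<nu>) [1..<Suc ?m] =
        map (\<lambda>i. ?l ! (i - 1)) (filter (\<lambda>i. i \<notin> Z) [1..<Suc k])"
    proof -
      have "map (Poly_Mapping.lookup ?\<nu>) [1..<Suc ?m] =
          map (Poly_Mapping.lookup \<mu>) (map ?e [1..<Suc ?m])"
        by (simp add: map_key.rep_eq inj del: upt_Suc)
      also have "\<dots> = map (Poly_Mapping.lookup \<mu>) (filter (\<lambda>i. i \<notin> Z) [1..<Suc k])"
        by (simp only: map_enumerate_complement[OF assms])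
      also have "\<dots> = map (\<lambda>i. ?l ! (i - 1)) (filter (\<lambda>i. i \<notin> Z) [1..<Suc k])"
        using nth by (intro map_cong refl) (auto simp del: upt_Suc)
      finally show ?thesis .
    qed
    ultimately show ?thesis
      unfolding omit_def series_def mcoeff_Abs disj[symmetric] using True by (simp del: upt_Suc)
  next
    case False
    then show ?thesis
      unfolding omit_def series_def mcoeff_Abs disj[symmetric] by simp
  qed
qed

definition zeros :: "nat list \<Rightarrow> nat set" where
  "zeros l = {p. p < length l \<and> l ! p = 0}"

lemma zeros_empty_iff: "zeros l = {} \<longleftrightarrow> 0 \<notin> set l"
  by (auto simp: zeros_def in_set_conv_nth)

text \<open>\<open>omit\<close> forces the parts in \<open>Z\<close> to vanish and
  \<open>gen_series\<close> forces the others to be positive, whence \<open>zeros l = Z\<close>. By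
  assumption \<open>A\<close> and \<open>des_filter\<close> the coefficient can be read from
  \<open>l\<close> itself instead of the list without zeros.\<close>

lemma omit_gen_series:
  assumes "finite Z" "Z \<subseteq> {..<k}" "m = k - card Z"
    and A: "\<And>l. length l = k \<Longrightarrow> zeros l = Z \<Longrightarrow> A (filter ((<) 0) l) = A l"
  shows "omit (Suc ` Z) (gen_series m A) = series k (\<lambda>l. if zeros l = Z then descent_poly l (A l) else 0)"
proof -
  have "card (Suc ` Z) = card Z"
    by (simp add: card_image)
  then have "omit (Suc ` Z) (gen_series m A) = omit (Suc ` Z) (gen_series (k - card (Suc ` Z)) A)"
    by (simp add: assms(3))
  also have "\<dots> = series k (\<lambda>l. if \<forall>i\<in>Suc ` Z. l ! (i - 1) = 0 then
      (\<lambda>l. if 0 \<notin> set l then descent_poly l (A l) else 0)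
        (map (\<lambda>i. l ! (i - 1)) (filter (\<lambda>i. i \<notin> Suc ` Z) [1..<Suc k])) else 0)"
    unfolding gen_series_eq using assms(1,2) by (intro omit_series) (auto simp: Suc_le_eq)
  also have "\<dots> = series k (\<lambda>l. if zeros l = Z then descent_poly l (A l) else 0)"
  proof (rule series_cong)
    fix l :: "nat list"
    assume len: "length l = k"
    have l: "l = map (\<lambda>i. l ! (i - 1)) [1..<Suc k]"
      by (rule nth_equalityI) (simp_all add: len del: upt_Suc)
    let ?l' = "map (\<lambda>i. l ! (i - 1)) (filter (\<lambda>i. i \<notin> Suc ` Z) [1..<Suc k])"
    have "(\<forall>i\<in>Suc ` Z. l ! (i - 1) = 0) \<longleftrightarrow> Z \<subseteq> zeros l"
      using assms(2) len by (auto simp: zeros_def)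
    moreover have "0 \<notin> set ?l' \<longleftrightarrow> zeros l \<subseteq> Z"
    proof -
      have "set [1..<Suc k] = Suc ` {..<k}"
        by (simp add: atLeastLessThanSuc_atLeastAtMost image_Suc_lessThan del: upt_Suc)
      then have "set ?l' = (\<lambda>i. l ! (i - 1)) ` Suc ` ({..<k} - Z)"
        by (auto simp del: upt_Suc)
      also have "\<dots> = (!) l ` ({..<k} - Z)"
        unfolding image_image by simp
      finally have l': "set ?l' = (!) l ` ({..<k} - Z)" .
      show ?thesis
        unfolding l' zeros_def len by force
    qed
    moreover have "?l' = filter ((<) 0) l" if "zeros l = Z"
    proof -
      have "i \<notin> Suc ` Z \<longleftrightarrow> 0 < l ! (i - 1)" if "i \<in> set [1..<Suc k]" for i
      proof -
        obtain q where q: "i = Suc q" "q < k"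
          using that \<open>i \<in> set [1..<Suc k]\<close> unfolding set_upt by (cases i) auto
        then have "i \<notin> Suc ` Z \<longleftrightarrow> q \<notin> zeros l"
          using \<open>zeros l = Z\<close> by auto
        then show ?thesis
          using q len by (simp add: zeros_def)
      qed
      then have "filter (\<lambda>i. i \<notin> Suc ` Z) [1..<Suc k] = filter (\<lambda>i. 0 < l ! (i - 1)) [1..<Suc k]"
        by (intro filter_cong) auto
      then have "?l' = filter ((<) 0) (map (\<lambda>i. l ! (i - 1)) [1..<Suc k])"
        by (simp only: filter_map comp_def)
      then show ?thesis
        by (simp only: l[symmetric])
    qed
    ultimately show "(if \<forall>i\<in>Suc ` Z. l ! (i - 1) = 0 then
        (\<lambda>l. if 0 \<notin> set l then descent_poly l (A l) else 0) ?l' else 0) =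
        (if zeros l = Z then descent_poly l (A l) else 0)"
      using A[OF len] by (auto simp: descent_poly_def des_filter simp del: upt_Suc)
  qed
  finally show ?thesis .
qed

lemma
  assumes "0 < k"
  shows gen_series_zeros: "gen_series k A = series k (\<lambda>l. if zeros l = {} then descent_poly l (A l) else 0)"
    and omit_first_L: "omit {1} (L (k - 1)) =
      series k (\<lambda>l. if zeros l = {0} then descent_poly l (unimodal_involutions l) else 0)"
proof -
  show "gen_series k A = series k (\<lambda>l. if zeros l = {} then descent_poly l (A l) else 0)"
    by (simp only: gen_series_eq zeros_empty_iff)
  show "omit {1} (L (k - 1)) =
      series k (\<lambda>l. if zeros l = {0} then descent_poly l (unimodal_involutions l) else 0)"
    using omit_gen_series[of "{0}" k "k - 1" unimodal_involutions] assms
    by (simp add: L_def unimodal_involutions_filter)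
qed

lemma omit_position:
  assumes "0 < p" "p < k"
  shows "omit {Suc p} (LI (k - 1) p) =
      series k (\<lambda>l. if zeros l = {p} then descent_poly l (unimodal_involutions_I p l) else 0)"
    and "omit {Suc p} (LD (k - 1) p) =
      series k (\<lambda>l. if zeros l = {p} then descent_poly l (unimodal_involutions_D p l) else 0)"
    and "omit {1, Suc p} (L (k - 2)) =
      series k (\<lambda>l. if zeros l = {0, p} then descent_poly l (unimodal_involutions l) else 0)"
proof -
  have take: "0 \<notin> set (take p l)" if "length l = k" "zeros l = {p}" for l
  proof
    assume "0 \<in> set (take p l)"
    then obtain q where q: "q < p" "q < length l" "l ! q = 0"
      by (auto simp: in_set_conv_nth)
    then have "q \<in> zeros l"
      by (simp add: zeros_def)
    then show False
      using that q by simp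
  qed
  note filt = unimodal_involutions_I_filter[OF take assms(1)]
  show "omit {Suc p} (LI (k - 1) p) =
      series k (\<lambda>l. if zeros l = {p} then descent_poly l (unimodal_involutions_I p l) else 0)"
    using omit_gen_series[of "{p}" k "k - 1" "unimodal_involutions_I p"] assms filt(1)
    by (simp add: LI_def)
  show "omit {Suc p} (LD (k - 1) p) =
      series k (\<lambda>l. if zeros l = {p} then descent_poly l (unimodal_involutions_D p l) else 0)"
    using omit_gen_series[of "{p}" k "k - 1" "unimodal_involutions_D p"] assms filt(2)
    by (simp add: LD_def)
  show "omit {1, Suc p} (L (k - 2)) =
      series k (\<lambda>l. if zeros l = {0, p} then descent_poly l (unimodal_involutions l) else 0)"
    using omit_gen_series[of "{0, p}" k "k - 2" unimodal_involutions] assms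
    by (simp add: L_def unimodal_involutions_filter numeral_2_eq_2)
qed

section \<open>Recurrences for the generating functions\<close>

text \<open>The series E_i; the shift passes from the numbering of variables, from 1, to that of
  segments, from 0.\<close>

definition LE :: "nat \<Rightarrow> nat \<Rightarrow> int poly mfps" where
  "LE k i = gen_series k (starting_in (i - 1))"

definition LDE :: "nat \<Rightarrow> nat \<Rightarrow> int poly mfps" where
  "LDE k i = gen_series k (starting_in_decreasing (i - 1))"

text \<open>
  Coefficient comparison after removing $1$ from the first part and from part \<open>p\<close>: a side
  condition on the vanishing parts of \<open>decr p (decr 0 l)\<close> singles out the term on the right.
\<close>

lemma series_X_X_cong:
  assumes p: "0 < p" "p < k"
    and pos: "\<And>l l'. length l = k \<Longrightarrow> zeros l = {} \<Longrightarrow> l' = decr p (decr 0 l) \<Longrightarrow>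
      zeros l' = (if l ! 0 = 1 then {0} else {}) \<union> (if l ! p = 1 then {p} else {}) \<Longrightarrow>
      l' ! 0 = l ! 0 - 1 \<Longrightarrow> 0 < l ! 0 \<Longrightarrow> 0 < l ! p \<Longrightarrow> f l = c l'"
    and nonpos: "\<And>l. length l = k \<Longrightarrow> zeros l \<noteq> {} \<Longrightarrow> f l = 0"
      "\<And>l. length l = k \<Longrightarrow> \<not> zeros l \<subseteq> {0, p} \<Longrightarrow> c l = 0"
  shows "series k f = X 1 * X (Suc p) * series k c"
proof -
  have rhs: "X 1 * X (Suc p) * series k c =
      series k (\<lambda>l. if 0 < l ! 0 then if 0 < decr 0 l ! p then c (decr p (decr 0 l)) else 0 else 0)"
    using p by (simp add: mult.assoc series_X)
  show ?thesis
    unfolding rhs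
  proof (rule series_cong)
    fix l :: "nat list"
    assume len: "length l = k"
    let ?l' = "decr p (decr 0 l)"
    have nth: "?l' ! q = l ! q - (if q = 0 \<or> q = p then 1 else 0)" if "q < k" for q
      using that p len by (auto simp: nth_decr)
    show "f l = (if 0 < l ! 0 then if 0 < decr 0 l ! p then c ?l' else 0 else 0)"
    proof (cases "zeros l = {}")
      case True
      then have l: "0 < l ! q" if "q < k" for q
        using that len by (auto simp: zeros_def)
      have "zeros ?l' = (if l ! 0 = 1 then {0} else {}) \<union> (if l ! p = 1 then {p} else {})"
      proof (rule set_eqI)
        fix q
        show "q \<in> zeros ?l' \<longleftrightarrow> q \<in> (if l ! 0 = 1 then {0} else {}) \<union> (if l ! p = 1 then {p} else {})"
        proof (cases "q < k")
          case True
          then show ?thesis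
            using l[of q] p nth[of q] len by (auto simp: zeros_def)
        next
          case False
          then show ?thesis
            using p len by (auto simp: zeros_def)
        qed
      qed
      then have "f l = c ?l'"
        using pos[OF len True refl] l[of 0] l[of p] nth[of 0] p by simp
      then show ?thesis
        using l[of 0] l[of p] p len by (simp add: nth_decr)
    next
      case False
      \<comment> \<open>A zero of \<open>l\<close> at 0 or \<open>p\<close> makes the removal
        impossible. Any other zero survives in \<open>?l'\<close>, where \<open>c\<close>
        vanishes.\<close>
      have "c ?l' = 0" if "0 < l ! 0" "0 < decr 0 l ! p"
      proof -
        obtain q where q: "q < k" "l ! q = 0"
          using False len by (auto simp: zeros_def)
        have "l ! p \<noteq> 0" "l ! 0 \<noteq> 0"
          using that p len by (simp_all add: nth_decr)
        then have "q \<noteq> 0" "q \<noteq> p"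
          using q(2) by metis+
        moreover have "q \<in> zeros ?l'"
          using nth[OF q(1)] q len by (simp add: zeros_def)
        ultimately show ?thesis
          using len by (intro nonpos(2)) auto
      qed
      then show ?thesis
        using nonpos(1)[OF len False] by auto
    qed
  qed
qed

lemma LE_eq:
  assumes "2 \<le> i" "i \<le> k"
  shows "LE k i = X 1 * X i *
    ((T + 1) * omit {1} (L (k - 1))
     + omit {i} (LI (k - 1) (i - 1)) + (T - 1) * omit {i} (LD (k - 1) (i - 1))
     + omit {1, i} (L (k - 2))
     + T * (LI k i + (T - 1) * LD k i)
     + LI k (i - 1) + (T - 1) * LD k (i - 1))"
proof -
  define p where "p = i - 1"
  have p: "0 < p" "p < k" "0 < k" and i: "i = Suc p"
    using assms by (simp_all add: p_def)
  note gen = gen_series_zeros[OF p(3)]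
  show ?thesis
    unfolding i diff_Suc_1 omit_first_L[OF p(3)] omit_position[OF p(1,2)]
    unfolding LE_def LI_def LD_def gen series_T series_T_plus series_T_minus series_add diff_Suc_1
  proof (rule series_X_X_cong[OF p(1,2)], goal_cases)
    case (1 l l')
    have "0 \<notin> set l"
      using 1(2) by (simp add: zeros_empty_iff)
    with 1(1,3) p have "descent_poly l (starting_in p l) =
        step_poly p l' + (if 2 \<le> l ! p then t * step_poly (Suc p) l' else 0)"
      using descent_poly_starting_in(1)[of l p l'] by simp
    note eq = this
    \<comment> \<open>The guard for the second end becomes the same test for 1 that determines
      \<open>zeros l'\<close>. In each of the four cases only the series supported on that set of
      zeros contribute.\<close>
    have "0 < p" "p \<noteq> 0" "\<And>n. 0 < n \<Longrightarrow> 2 \<le> n \<longleftrightarrow> n \<noteq> (1::nat)"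
      using p by auto
    then show ?case
      unfolding eq step_poly_def 1(2,4,5) using 1(6,7)
      by (cases "l ! 0 = 1"; cases "l ! p = 1") (simp_all add: doubleton_eq_iff distrib_right add_ac del: One_nat_def)
  next
    case (3 l)
    have "zeros l \<noteq> {}" "zeros l \<noteq> {0}" "zeros l \<noteq> {p}" "zeros l \<noteq> {0, p}"
      using 3(2) by blast+
    then show ?case
      by simp
  qed simp
qed

text \<open>The two factors \<open>T\<close> at \<open>LD k i\<close> are the descent into the
  closing 1 and the one after the leading \<open>v\<close>. Moving this term to the left later gives
  the denominator with t^2.\<close>

lemma LDE_eq:
  assumes "2 \<le> i" "i \<le> k"
  shows "LDE k i = X 1 * X i *
    (T * (T * LD k i) + T * LD k (i - 1) + T * omit {i} (LD (k - 1) (i - 1))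
     + omit {1, i} (L (k - 2)) + (T + 1) * omit {1} (L (k - 1)))"
proof -
  define p where "p = i - 1"
  have p: "0 < p" "p < k" "0 < k" and i: "i = Suc p"
    using assms by (simp_all add: p_def)
  note gen = gen_series_zeros[OF p(3)]
  show ?thesis
    unfolding i diff_Suc_1 omit_first_L[OF p(3)] omit_position[OF p(1,2)]
    unfolding LDE_def LD_def gen series_T series_T_plus series_add diff_Suc_1
  proof (rule series_X_X_cong[OF p(1,2)], goal_cases)
    case (1 l l')
    have "0 \<notin> set l"
      using 1(2) by (simp add: zeros_empty_iff)
    with 1(1,3) p have "descent_poly l (starting_in_decreasing p l) =
        step_poly_decreasing p l' + (if 2 \<le> l ! p then t * step_poly_decreasing (Suc p) l' else 0)"
      using descent_poly_starting_in(2)[of l p l'] by simp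
    note eq = this
    have "0 < p" "p \<noteq> 0" "\<And>n. 0 < n \<Longrightarrow> 2 \<le> n \<longleftrightarrow> n \<noteq> (1::nat)"
      using p by auto
    then show ?case
      unfolding eq step_poly_decreasing_def 1(2,4,5) using 1(6,7)
      by (cases "l ! 0 = 1"; cases "l ! p = 1") (simp_all add: doubleton_eq_iff distrib_right add_ac del: One_nat_def)
  next
    case (3 l)
    have "zeros l \<noteq> {}" "zeros l \<noteq> {0}" "zeros l \<noteq> {p}" "zeros l \<noteq> {0, p}"
      using 3(2) by blast+
    then show ?case
      by simp
  qed simp
qed

text \<open>The two summands match the two ends of the first segment: one removed position for a
  fixed point 1, two for a 2-cycle inside the segment.\<close>

lemma series_X1_cong:
  assumes k: "0 < k"
    and pos: "\<And>l. length l = k \<Longrightarrow> zeros l = {} \<Longrightarrow> 0 < l ! 0 \<Longrightarrow>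
      f l = c (decr 0 l) + (if 2 \<le> l ! 0 then d (decr 0 (decr 0 l)) else 0)"
    and nonpos: "\<And>l. length l = k \<Longrightarrow> zeros l \<noteq> {} \<Longrightarrow> f l = 0"
      "\<And>l. length l = k \<Longrightarrow> \<not> zeros l \<subseteq> {0} \<Longrightarrow> c l = 0 \<and> d l = 0"
  shows "series k f = X 1 * series k c + X 1 ^ 2 * series k d"
proof -
  have rhs: "X 1 * series k c + X 1 ^ 2 * series k d =
      series k (\<lambda>l. (if 0 < l ! 0 then c (decr 0 l) else 0) +
        (if 0 < l ! 0 then if 0 < decr 0 l ! 0 then d (decr 0 (decr 0 l)) else 0 else 0))"
    using k by (simp add: power2_eq_square mult.assoc series_X series_add)
  show ?thesis
    unfolding rhs
  proof (rule series_cong)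
    fix l :: "nat list"
    assume len: "length l = k"
    have nth: "decr 0 l ! 0 = l ! 0 - 1"
      using k len by (simp add: nth_decr)
    show "f l = (if 0 < l ! 0 then c (decr 0 l) else 0) +
        (if 0 < l ! 0 then if 0 < decr 0 l ! 0 then d (decr 0 (decr 0 l)) else 0 else 0)"
    proof (cases "zeros l = {}")
      case True
      then have "0 < l ! 0"
        using k len by (auto simp: zeros_def)
      then show ?thesis
        using pos[OF len True] nth by auto
    next
      case False
      then obtain q where q: "q < k" "l ! q = 0"
        using len by (auto simp: zeros_def)
      have "c (decr 0 l) = 0 \<and> d (decr 0 (decr 0 l)) = 0" if "0 < l ! 0"
      proof -
        have "q \<noteq> 0"
          using that q(2) by (metis less_irrefl)
        then have "q \<in> zeros (decr 0 l)" "q \<in> zeros (decr 0 (decr 0 l))"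
          using q len by (simp_all add: zeros_def nth_decr)
        then show ?thesis
          using nonpos(2)[of "decr 0 l"] nonpos(2)[of "decr 0 (decr 0 l)"] len \<open>q \<noteq> 0\<close> by auto
      qed
      then show ?thesis
        using nonpos(1)[OF len False] by auto
    qed
  qed
qed

lemma decr_first:
  assumes "length l = k" "zeros l = {}" "0 < k"
  shows "zeros (decr 0 l) = (if l ! 0 = 1 then {0} else {})"
    and "2 \<le> l ! 0 \<Longrightarrow> zeros (decr 0 (decr 0 l)) = (if l ! 0 = 2 then {0} else {})"
    and "decr 0 (decr 0 l) ! 0 = l ! 0 - 2"
proof -
  have pos: "l ! q \<noteq> 0" if "q < k" for q
    using assms(1,2) that by (auto simp: zeros_def)
  have nth: "decr 0 l ! q = l ! q - (if q = 0 then 1 else 0)"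
      "decr 0 (decr 0 l) ! q = l ! q - (if q = 0 then 2 else 0)" if "q < k" for q
    using that assms(1) by (auto simp: nth_decr)
  have "q \<in> zeros (decr 0 l) \<longleftrightarrow> q = 0 \<and> l ! 0 = 1" for q
    using pos[of q] nth(1)[of q] assms(1,3) by (cases "q = 0") (auto simp: zeros_def)
  then show "zeros (decr 0 l) = (if l ! 0 = 1 then {0} else {})"
    by auto
  have "q \<in> zeros (decr 0 (decr 0 l)) \<longleftrightarrow> q = 0 \<and> l ! 0 = 2" if "2 \<le> l ! 0" for q
    using pos[of q] nth(2)[of q] assms(1,3) that by (cases "q = 0") (auto simp: zeros_def)
  then show "zeros (decr 0 (decr 0 l)) = (if l ! 0 = 2 then {0} else {})" if "2 \<le> l ! 0"
    using that by auto
  show "decr 0 (decr 0 l) ! 0 = l ! 0 - 2"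
    using nth(2)[of 0] assms(3) by simp
qed

text \<open>A fixed point 1 in a longer first segment leaves an arbitrary involution with k parts.
  This is the term \<open>X 1 * L k\<close>, the source of the denominator 1 - x_1.\<close>

lemma LE_1_eq:
  assumes "1 \<le> k"
  shows "LE k 1 = X 1 * (L k + omit {1} (L (k - 1)))
    + X 1 ^ 2 * (T * (omit {1} (L (k - 1)) + (LI k 1 + (T - 1) * LD k 1)))"
proof -
  have k: "0 < k"
    using assms by simp
  note gen = gen_series_zeros[OF k]
  show ?thesis
    unfolding omit_first_L[OF k]
    unfolding LE_def LI_def LD_def L_def gen series_T series_T_minus series_add
  proof (rule series_X1_cong[OF k], goal_cases)
    case (1 l)
    have pos: "0 \<notin> set l" "l \<noteq> []"
      using 1 k by (auto simp: zeros_empty_iff)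
    show ?case
      using descent_poly_starting_in_0(1)[OF pos refl] decr_first[OF 1(1,2) k] 1
      by (auto simp: step_poly_def)
  next
    case (3 l)
    have "zeros l \<noteq> {}" "zeros l \<noteq> {0}"
      using 3(2) by blast+
    then show ?case
      by simp
  qed simp
qed

text \<open>A fixed point 1 heads a decreasing segment only if it is alone there, so its
  contribution is the single term in which the first part disappears.\<close>

lemma LDE_1_eq:
  assumes "1 \<le> k"
  shows "LDE k 1 = X 1 * omit {1} (L (k - 1)) + X 1 ^ 2 * (T * (omit {1} (L (k - 1)) + T * LD k 1))"
proof -
  have k: "0 < k"
    using assms by simp
  note gen = gen_series_zeros[OF k]
  show ?thesis
    unfolding omit_first_L[OF k]
    unfolding LDE_def LD_def L_def gen series_T series_add
  proof (rule series_X1_cong[OF k], goal_cases)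
    case (1 l)
    have pos: "0 \<notin> set l" "l \<noteq> []"
      using 1 k by (auto simp: zeros_empty_iff)
    show ?case
      using descent_poly_starting_in_0(2)[OF pos refl] decr_first[OF 1(1,2) k] 1
      by (auto simp: step_poly_decreasing_def)
  next
    case (3 l)
    have "zeros l \<noteq> {}" "zeros l \<noteq> {0}"
      using 3(2) by blast+
    then show ?case
      by simp
  qed simp
qed

lemma L_eq_sum:
  assumes "1 \<le> k"
  shows "L k = (\<Sum>i=1..k. LE k i)"
    and "j \<le> k \<Longrightarrow> LI k j = LD k j + (\<Sum>i=Suc j..k. LE k i)"
proof -
  have k: "0 < k"
    using assms by simp
  note gen = gen_series_zeros[OF k]
  have shift: "(\<Sum>i=Suc j..k. LE k i) = (\<Sum>p\<in>{j..<k}. gen_series k (starting_in p))" for j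
    by (rule sum.reindex_bij_witness[of _ Suc "\<lambda>i. i - 1"]) (auto simp: LE_def)
  have "L k = (\<Sum>p\<in>{0..<k}. gen_series k (starting_in p))"
    unfolding L_def gen series_sum[OF finite_atLeastLessThan]
  proof (rule series_cong)
    fix l :: "nat list"
    assume "length l = k"
    then show "(if zeros l = {} then descent_poly l (unimodal_involutions l) else 0) =
        (\<Sum>p\<in>{0..<k}. if zeros l = {} then descent_poly l (starting_in p l) else 0)"
      using descent_poly_eq_sum_starting_in(1)[of l] k by (auto simp: zeros_empty_iff atLeast0LessThan)
  qed
  then show "L k = (\<Sum>i=1..k. LE k i)"
    using shift[of 0] by simp
  assume j: "j \<le> k"
  show "LI k j = LD k j + (\<Sum>i=Suc j..k. LE k i)"
    unfolding shift LI_def LD_def gen series_sum[OF finite_atLeastLessThan] series_add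
  proof (rule series_cong)
    fix l :: "nat list"
    assume "length l = k"
    then show "(if zeros l = {} then descent_poly l (unimodal_involutions_I j l) else 0) =
        (if zeros l = {} then descent_poly l (unimodal_involutions_D j l) else 0) +
        (\<Sum>p\<in>{j..<k}. if zeros l = {} then descent_poly l (starting_in p l) else 0)"
      using descent_poly_eq_sum_starting_in(2)[of l j] j k by (auto simp: zeros_empty_iff)
  qed
qed

lemma LD_eq:
  assumes "1 \<le> k"
  shows "LD k 1 = LDE k 1" and "2 \<le> i \<Longrightarrow> LD k i = LD k (i - 1) + LDE k i"
proof -
  have k: "0 < k"
    using assms by simp
  note gen = gen_series_zeros[OF k]
  have Suc: "LD k (Suc j) = gen_series k (unimodal_involutions_D j) + LDE k (Suc j)" for j
    unfolding LD_def LDE_def gen series_add by (rule series_cong) (simp add: descent_poly_D_Suc)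
  have "gen_series k (unimodal_involutions_D 0) = series k (\<lambda>_. 0)"
    unfolding gen using k
    by (intro series_cong) (auto simp: zeros_empty_iff unimodal_involutions_D_0 descent_poly_def)
  then show "LD k 1 = LDE k 1"
    using Suc[of 0] by (simp add: series_0)
  show "LD k i = LD k (i - 1) + LDE k i" if "2 \<le> i"
    using Suc[of "i - 1"] that by (simp add: LD_def)
qed

section \<open>Initial values and solving for the unknown series\<close>

lemma L_0: "L 0 = 1"
proof (rule mfps_eqI)
  fix \<mu> :: "nat \<Rightarrow>\<^sub>0 nat"
  have "unimodal_involutions [] = {id}"
    by (auto simp: unimodal_involutions_eq involutions_def fun_eq_iff)
  then show "mcoeff (L 0) \<mu> = mcoeff 1 \<mu>"
    by (auto simp: L_def gen_series_eq series_def descent_poly_def des_def one_pCons monom_0)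
qed

lemma omit_1:
  assumes "finite S"
  shows "omit S 1 = 1"
proof (rule mfps_eqI)
  fix \<mu> :: "nat \<Rightarrow>\<^sub>0 nat"
  let ?e = "enumerate (- S)"
  have inf: "infinite (- S)"
    using assms by simp
  have inj: "inj ?e"
    using inf by (intro strict_mono_imp_inj_on strict_mono_enumerate)
  have "\<mu> = 0" if disj: "Poly_Mapping.keys \<mu> \<inter> S = {}" and 0: "Poly_Mapping.map_key ?e \<mu> = 0"
  proof (rule poly_mapping_eqI)
    fix x
    show "Poly_Mapping.lookup \<mu> x = Poly_Mapping.lookup 0 x"
    proof (cases "x \<in> Poly_Mapping.keys \<mu>")
      case True
      then obtain n where "x = ?e n"
        using disj range_enumerate[OF inf] by blast
      then have "Poly_Mapping.lookup \<mu> x = Poly_Mapping.lookup (Poly_Mapping.map_key ?e \<mu>) n"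
        by (simp add: map_key.rep_eq inj)
      then show ?thesis
        by (simp add: 0)
    qed (simp add: in_keys_iff)
  qed
  moreover have "Poly_Mapping.map_key ?e (0 :: nat \<Rightarrow>\<^sub>0 nat) = 0"
    by (rule poly_mapping_eqI) (simp add: map_key.rep_eq inj)
  ultimately show "mcoeff (omit S 1) \<mu> = mcoeff 1 \<mu>"
    by (auto simp: omit_def)
qed

lemma mfps_eq_unit_inverse:
  fixes a b f :: "int poly mfps"
  assumes "a dvd 1" "a * f = b"
  shows "f = 1 / a * b"
proof -
  have "f = b / a"
    using assms by (simp add: mfps_divide_iff)
  then show ?thesis
    by (simp add: divide_mfps_def mult.commute)
qed

lemma LD_1_eq:
  assumes "1 \<le> k"
  shows "(1 - X 1 * T) * LD k 1 = X 1 * omit {1} (L (k - 1))"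
proof -
  let ?D = "LD k 1" and ?O = "omit {1} (L (k - 1))"
  have "?D = X 1 * ?O + X 1 ^ 2 * (T * (?O + T * ?D))"
    using LD_eq(1) LDE_1_eq assms by metis
  then have zero: "(1 + X 1 * T) * ((1 - X 1 * T) * ?D - X 1 * ?O) = 0"
    by (simp add: algebra_simps power2_eq_square)
  \<comment> \<open>Constant coefficient 1 makes this factor a unit, so it is cancelled by
    multiplying with its inverse \<open>u\<close>.\<close>
  have "1 + X 1 * T dvd (1 :: int poly mfps)"
    using mfps_one_minus_X_dvd_one[of 1 "- T"] by simp
  then obtain u where u: "1 = (1 + X 1 * T) * u"
    by (elim dvdE)
  have "(1 - X 1 * T) * ?D - X 1 * ?O = ((1 + X 1 * T) * u) * ((1 - X 1 * T) * ?D - X 1 * ?O)"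
    by (simp only: u[symmetric] mult_1_left)
  also have "\<dots> = u * ((1 + X 1 * T) * ((1 - X 1 * T) * ?D - X 1 * ?O))"
    by (simp only: mult_ac)
  finally have "(1 - X 1 * T) * ?D - X 1 * ?O = 0"
    by (simp only: zero mult_zero_right)
  then show ?thesis
    by simp
qed

lemma L_1: "L 1 = X 1 / ((1 - X 1) * (1 - X 1 * T))"
proof -
  let ?x = "X 1 :: int poly mfps" and ?D = "LD 1 1"
  have O: "omit {1} (L (1 - 1)) = 1"
    by (simp add: L_0 omit_1)
  have D: "(1 - ?x * T) * ?D = ?x"
    using LD_1_eq[of 1] unfolding O by simp
  have "L 1 = LE 1 1" "LI 1 1 = ?D"
    using L_eq_sum(1)[of 1] L_eq_sum(2)[of 1 1] by simp_all
  then have L: "L 1 = ?x * (L 1 + 1) + ?x ^ 2 * (T * (1 + T * ?D))"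
    using LE_1_eq[of 1] unfolding O by (simp add: algebra_simps)
  have "(1 - ?x) * L 1 = ?x + ?x ^ 2 * T + ?x ^ 2 * T * T * ?D"
    using L by (simp add: algebra_simps)
  \<comment> \<open>The factor 1 - x t eliminates \<open>?D\<close> through \<open>D\<close>; then
    (1 - x t)(x + x^2 t) = x - x^3 t^2, and the last summand restores x^3 t^2.\<close>
  then have "(1 - ?x * T) * ((1 - ?x) * L 1) =
      (1 - ?x * T) * (?x + ?x ^ 2 * T) + ?x ^ 2 * T * T * ((1 - ?x * T) * ?D)"
    by (simp only: distrib_left mult_ac)
  also have "\<dots> = ?x"
    unfolding D by (simp add: algebra_simps power2_eq_square)
  finally have "(1 - ?x) * (1 - ?x * T) * L 1 = ?x"
    by (simp only: mult_ac)
  moreover have "(1 - ?x) * (1 - ?x * T) dvd 1"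
    using mult_dvd_mono[OF mfps_one_minus_X_dvd_one[of 1 1] mfps_one_minus_X_dvd_one[of 1 T]] by simp
  ultimately show ?thesis
    by (simp add: mfps_divide_iff)
qed

lemma L_recurrence:
  assumes "2 \<le> k"
  shows "L k = 1 / (1 - X 1) *
    ((X 1 + X 1 ^ 2 * T) * omit {1} (L (k - 1)) + X 1 ^ 2 * T * (LI k 1 + (T - 1) * LD k 1)
     + (\<Sum>i=2..k. LE k i))"
proof (rule mfps_eq_unit_inverse)
  show "1 - X 1 dvd (1 :: int poly mfps)"
    using mfps_one_minus_X_dvd_one[of 1 1] by simp
  have "L k = LE k 1 + (\<Sum>i=2..k. LE k i)"
    using L_eq_sum(1)[of k] assms by (simp add: sum.atLeast_Suc_atMost numeral_2_eq_2)
  then show "(1 - X 1) * L k = (X 1 + X 1 ^ 2 * T) * omit {1} (L (k - 1)) +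
      X 1 ^ 2 * T * (LI k 1 + (T - 1) * LD k 1) + (\<Sum>i=2..k. LE k i)"
    using LE_1_eq[of k] assms by (simp add: algebra_simps)
qed

text \<open>For \<open>i = j + 1\<close> the summand \<open>X 1 * X i * LI k (i - 1)\<close>
  contains the unknown \<open>LI k j\<close> itself. Moving it to the left produces the denominator
  and lets the remaining sum start at \<open>j + 2\<close>; \<open>R i\<close> is the rest of
  E_i.\<close>

lemma LI_recurrence:
  assumes "1 \<le> j" "j < k" "\<And>i. j + 1 \<le> i \<Longrightarrow> i \<le> k \<Longrightarrow> LE k i = X 1 * X i * LI k (i - 1) + R i"
  shows "LI k j = 1 / (1 - X 1 * X (j + 1)) *
    (LD k j + (\<Sum>i=j+2..k. X 1 * X i * LI k (i - 1)) + (\<Sum>i=j+1..k. R i))"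
proof (rule mfps_eq_unit_inverse)
  show "1 - X 1 * X (j + 1) dvd (1 :: int poly mfps)"
    by (rule mfps_one_minus_X_dvd_one)
  have "LI k j = LD k j + (\<Sum>i=j+1..k. LE k i)"
    using L_eq_sum(2)[of k j] assms by simp
  also have "(\<Sum>i=j+1..k. LE k i) = (\<Sum>i=j+1..k. X 1 * X i * LI k (i - 1)) + (\<Sum>i=j+1..k. R i)"
    using assms(3) by (simp add: sum.distrib[symmetric])
  also have "(\<Sum>i=j+1..k. X 1 * X i * LI k (i - 1)) =
      X 1 * X (j + 1) * LI k j + (\<Sum>i=j+2..k. X 1 * X i * LI k (i - 1))"
    using assms(2) by (simp add: sum.atLeast_Suc_atMost)
  finally show "(1 - X 1 * X (j + 1)) * LI k j =
      LD k j + (\<Sum>i=j+2..k. X 1 * X i * LI k (i - 1)) + (\<Sum>i=j+1..k. R i)"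
    by (simp add: algebra_simps)
qed

theorem theorem5p1:
  "L 0 = 1 \<and>
   L 1 = X 1 / ((1 - X 1) * (1 - X 1 * T)) \<and>
   (\<forall>k\<ge>2.
      L k = 1 / (1 - X 1) *
        ((X 1 + X 1 ^ 2 * T) * omit {1} (L (k - 1))
         + X 1 ^ 2 * T * (LI k 1 + (T - 1) * LD k 1)
         + (\<Sum>i=2..k. X 1 * X i *
             ((T + 1) * omit {1} (L (k - 1))
              + omit {i} (LI (k - 1) (i - 1)) + (T - 1) * omit {i} (LD (k - 1) (i - 1))
              + omit {1, i} (L (k - 2))
              + T * (LI k i + (T - 1) * LD k i)
              + LI k (i - 1) + (T - 1) * LD k (i - 1))))) \<and>
   (\<forall>k\<ge>1. LI k k = LD k k) \<and>
   (\<forall>k j. 1 \<le> j \<and> j < k \<longrightarrow>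
      LI k j = 1 / (1 - X 1 * X (j + 1)) *
        (LD k j
         + (\<Sum>i=j+2..k. X 1 * X i * LI k (i - 1))
         + (\<Sum>i=j+1..k. X 1 * X i *
             ((T + 1) * omit {1} (L (k - 1))
              + omit {i} (LI (k - 1) (i - 1)) + (T - 1) * omit {i} (LD (k - 1) (i - 1))
              + omit {1, i} (L (k - 2))
              + T * (LI k i + (T - 1) * LD k i)
              + (T - 1) * LD k (i - 1))))) \<and>
   (\<forall>k\<ge>1. LD k 1 = X 1 / (1 - X 1 * T) * omit {1} (L (k - 1))) \<and>
   (\<forall>k i. 2 \<le> i \<and> i \<le> k \<longrightarrow>
      LD k i = 1 / (1 - X 1 * X i * T ^ 2) *
        (LD k (i - 1)
         + X 1 * X i *
             (T * LD k (i - 1) + T * omit {i} (LD (k - 1) (i - 1))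
              + omit {1, i} (L (k - 2)) + (T + 1) * omit {1} (L (k - 1)))))"
proof (intro conjI allI impI)
  show "L 0 = 1"
    by (rule L_0)
  show "L 1 = X 1 / ((1 - X 1) * (1 - X 1 * T))"
    by (rule L_1)
next
  fix k :: nat
  assume k: "2 \<le> k"
  have "(\<Sum>i=2..k. LE k i) = (\<Sum>i=2..k. X 1 * X i *
      ((T + 1) * omit {1} (L (k - 1))
       + omit {i} (LI (k - 1) (i - 1)) + (T - 1) * omit {i} (LD (k - 1) (i - 1))
       + omit {1, i} (L (k - 2))
       + T * (LI k i + (T - 1) * LD k i)
       + LI k (i - 1) + (T - 1) * LD k (i - 1)))"
    by (intro sum.cong refl LE_eq) auto
  then show "L k = 1 / (1 - X 1) *
        ((X 1 + X 1 ^ 2 * T) * omit {1} (L (k - 1))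
         + X 1 ^ 2 * T * (LI k 1 + (T - 1) * LD k 1)
         + (\<Sum>i=2..k. X 1 * X i *
             ((T + 1) * omit {1} (L (k - 1))
              + omit {i} (LI (k - 1) (i - 1)) + (T - 1) * omit {i} (LD (k - 1) (i - 1))
              + omit {1, i} (L (k - 2))
              + T * (LI k i + (T - 1) * LD k i)
              + LI k (i - 1) + (T - 1) * LD k (i - 1))))"
    using L_recurrence[OF k] by metis
next
  fix k :: nat
  assume "1 \<le> k"
  then show "LI k k = LD k k"
    using L_eq_sum(2)[of k k] by simp
next
  fix k j :: nat
  assume j: "1 \<le> j \<and> j < k"
  show "LI k j = 1 / (1 - X 1 * X (j + 1)) *
        (LD k j
         + (\<Sum>i=j+2..k. X 1 * X i * LI k (i - 1))
         + (\<Sum>i=j+1..k. X 1 * X i *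
             ((T + 1) * omit {1} (L (k - 1))
              + omit {i} (LI (k - 1) (i - 1)) + (T - 1) * omit {i} (LD (k - 1) (i - 1))
              + omit {1, i} (L (k - 2))
              + T * (LI k i + (T - 1) * LD k i)
              + (T - 1) * LD k (i - 1))))"
  proof (rule LI_recurrence)
    fix i
    assume i: "j + 1 \<le> i" "i \<le> k"
    show "LE k i = X 1 * X i * LI k (i - 1) + X 1 * X i *
             ((T + 1) * omit {1} (L (k - 1))
              + omit {i} (LI (k - 1) (i - 1)) + (T - 1) * omit {i} (LD (k - 1) (i - 1))
              + omit {1, i} (L (k - 2))
              + T * (LI k i + (T - 1) * LD k i)
              + (T - 1) * LD k (i - 1))"
      unfolding distrib_left[symmetric] using LE_eq[of i k] i j by (simp add: add_ac)
  qed (use j in auto)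
next
  fix k :: nat
  assume "1 \<le> k"
  then show "LD k 1 = X 1 / (1 - X 1 * T) * omit {1} (L (k - 1))"
    using mfps_eq_unit_inverse[OF mfps_one_minus_X_dvd_one LD_1_eq[of k]]
    by (simp add: divide_mfps_def mult_ac)
next
  fix k i :: nat
  assume i: "2 \<le> i \<and> i \<le> k"
  have "LD k i = LD k (i - 1) + LDE k i"
    using LD_eq(2)[of k i] i by simp
  \<comment> \<open>The bracketing fits the pattern of \<open>mfps_one_minus_X_dvd_one\<close>,
    which supplies invertibility.\<close>
  then have "(1 - X 1 * (X i * T ^ 2)) * LD k i = LD k (i - 1) + X 1 * X i *
      (T * LD k (i - 1) + T * omit {i} (LD (k - 1) (i - 1))
       + omit {1, i} (L (k - 2)) + (T + 1) * omit {1} (L (k - 1)))"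
    using LDE_eq[of i k] i by (simp add: algebra_simps power2_eq_square)
  then show "LD k i = 1 / (1 - X 1 * X i * T ^ 2) *
        (LD k (i - 1)
         + X 1 * X i *
             (T * LD k (i - 1) + T * omit {i} (LD (k - 1) (i - 1))
              + omit {1, i} (L (k - 2)) + (T + 1) * omit {1} (L (k - 1))))"
    using mfps_eq_unit_inverse[OF mfps_one_minus_X_dvd_one] by (metis mult.assoc)
qed

end
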